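(* For every $\tau\in\mathbb{H}^2$ set $$f(\tau)=\frac{11+5\sqrt5}{2}\prod_{n=1}^{\infty}\frac{\left(1+\frac{1+\sqrt5}{2}q^n+q^{2n}\right)^5}{\left(1+\frac{1-\sqrt5}{2}q^n+q^{2n}\right)^5},\qquad q=\exp(2\pi i\tau),$$ and $$S(\tau)=\frac{\sqrt{250-110\sqrt5}}{5}\prod_{n=1}^{\infty}\frac{(1-q^n)^5}{(1-q^{5n})^3}\left(1+\frac{1-\sqrt5}{2}q^n+q^{2n}\right)^5 .$$ Then the inverse function $\tau=\tau(f)$ yields $S(f)=S(\tau(f))$, and $S(f)$ satisfies the differential equation $$\frac{d^2S}{df^2}+\left\{\frac1f+\frac{1}{f-\frac{11+5\sqrt5}{2}}+\frac{1}{f-\frac{11-5\sqrt5}{2}}\right\}\frac{dS}{df}+\frac{f-3}{f\left(f-\frac{11+5\sqrt5}{2}\right)\left(f-\frac{11-5\sqrt5}{2}\right)}\,S=0 .$$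
   Context: $\mathbb{H}^2=\{\tau\in\mathbb{C}\mid \Im\tau>0\}$. The inverse function $\tau=\tau(f)$ means any local holomorphic inverse of $\tau\mapsto f(\tau)$; thus $S$ is regarded locally as a function of the variable $f$. *)

theory Defs
  imports "HOL-Analysis.Analysis"
begin

definition upper_half_plane :: "complex set" where
  "upper_half_plane = {\<tau>. Im \<tau> > 0}"

definition nome :: "complex \<Rightarrow> complex" where
  "nome \<tau> = exp (2 * of_real pi * \<i> * \<tau>)"

definition fsing_plus :: complex where
  "fsing_plus = of_real ((11 + 5 * sqrt 5) / 2)"

definition fsing_minus :: complex where
  "fsing_minus = of_real ((11 - 5 * sqrt 5) / 2)"

(* The library's infinite products are indexed from 0, so the n-th factor is taken at Suc n. *)

definition f_mod :: "complex \<Rightarrow> complex" where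
  "f_mod \<tau> = (let q = nome \<tau> in
     fsing_plus *
     (\<Prod>n. (1 + of_real ((1 + sqrt 5) / 2) * q ^ Suc n + q ^ (2 * Suc n)) ^ 5 /
           (1 + of_real ((1 - sqrt 5) / 2) * q ^ Suc n + q ^ (2 * Suc n)) ^ 5))"

definition S_mod :: "complex \<Rightarrow> complex" where
  "S_mod \<tau> = (let q = nome \<tau> in
     of_real (sqrt (250 - 110 * sqrt 5) / 5) *
     (\<Prod>n. (1 - q ^ Suc n) ^ 5 / (1 - q ^ (5 * Suc n)) ^ 3 *
           (1 + of_real ((1 - sqrt 5) / 2) * q ^ Suc n + q ^ (2 * Suc n)) ^ 5))"

(* g is a branch, defined on the open set U of the f-plane, of the inverse function
   tau = tau(f).  The identity f_mod (g w) = w makes g injective, so g ` U is open and g is a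
   two-sided inverse of the restriction of f_mod to g ` U. *)

definition local_inverse_branch :: "complex set \<Rightarrow> (complex \<Rightarrow> complex) \<Rightarrow> bool" where
  "local_inverse_branch U g \<longleftrightarrow>
     open U \<and> g holomorphic_on U \<and> g ` U \<subseteq> upper_half_plane \<and> (\<forall>w\<in>U. f_mod (g w) = w)"

end

theory Submission
  imports Defs "HOL-Complex_Analysis.Complex_Analysis"
begin

text \<open>
  Write \<open>D = q d/dq\<close> and, for \<open>x \<noteq> 1\<close> in the annulus \<open>norm q < norm x < 1 / norm q\<close>, let
  \<open>rho q x\<close> and \<open>wp q x\<close> be minus the logarithmic derivatives, under \<open>x d/dx\<close> and under \<open>D\<close>, of the
  theta function \<open>(x\<^sup>1\<^sup>/\<^sup>2 - x\<^sup>-\<^sup>1\<^sup>/\<^sup>2) \<Prod>(1 - x q^n) (1 - q^n / x)\<close>; both are given by Lambert series.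
  Both infinite products of the theorem are made of such theta products at \<open>x = 1\<close>, \<open>\<zeta>\<close> and \<open>\<zeta>\<^sup>2\<close>, where
  \<open>\<zeta>\<close> is a primitive fifth root of unity, so \<open>D log f\<close> and \<open>D log S\<close> are linear in \<open>wp\<close> at these points.

  Everything rests on one addition theorem (lemma \<open>addition\<close>), which expresses
  \<open>wp q x + wp q y + wp q (x y)\<close> through products of values of \<open>rho\<close>. Its proof is a comparison of
  coefficients in bilateral series, resting on the partial fraction identity for \<open>1 / ((1 - u) (1 - v))\<close>.
  Its limit for \<open>y \<rightarrow> 1/x\<close> is Ramanujan's formula for \<open>x d/dx rho\<close> (lemma \<open>ramanujan\<close>), and
  differentiating it in \<open>x\<close> and \<open>y\<close> gives formulas for the higher derivatives. Since the series satisfy the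
  heat equation \<open>D rho = x d/dx wp\<close>, specialising to fifth roots of unity turns all this into a closed
  polynomial system: with \<open>a = rho q \<zeta>\<close>, \<open>b = rho q \<zeta>\<^sup>2\<close> and \<open>e = wp q 1\<close>, the derivatives \<open>D a\<close>, \<open>D b\<close>,
  \<open>D e\<close> are polynomials in \<open>a\<close>, \<open>b\<close>, \<open>e\<close>, and so are \<open>wp q \<zeta>\<close> and \<open>wp q \<zeta>\<^sup>2\<close>. This plays the part that
  the finite dimension of spaces of modular forms of level five plays in the classical argument.

  In this system the linear forms \<open>L = a - 3 b\<close> and \<open>M = 3 a + b\<close> satisfy \<open>D L = L G\<close> and
  \<open>D M = M (G + 5 V)\<close>, where \<open>V = a\<^sup>2 - 4 a b - b\<^sup>2 = wp q \<zeta> - wp q \<zeta>\<^sup>2\<close> and \<open>G\<close> is the logarithmic derivative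
  of \<open>S\<close>. Hence \<open>S\<close> is a constant multiple of \<open>L\<close>, and \<open>f = M / L\<close> because both sides have logarithmic
  derivative \<open>5 V\<close> and agree at \<open>q = 0\<close>. Moreover \<open>M\<^sup>2 - 11 M L - L\<^sup>2 = - 25 V\<close>, that is,
  \<open>(f - f\<^sub>+) (f - f\<^sub>-) L\<^sup>2 = - 25 V\<close> for the two finite singular points \<open>f\<^sub>\<plusminus> \<noteq> 0\<close>. As \<open>V\<close> solves a first order
  linear equation \<open>D V = V H\<close> and is not identically zero, it has no zero for \<open>0 < norm q < 1\<close> (lemma \<open>V5_nonzero\<close>). Therefore
  \<open>D f = 5 f V\<close> never vanishes, which gives the local inverses, and \<open>f\<close>, a
  constant times an exponential, avoids \<open>0\<close> as well as \<open>f\<^sub>\<plusminus>\<close>.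

  Finally \<open>D G = G\<^sup>2 + 10 b M V\<close>. With \<open>P = f (f - f\<^sub>+) (f - f\<^sub>-)\<close> the chain rule \<open>d/df = (5 f V)\<^sup>-\<^sup>1 D\<close> gives
  \<open>P dL/df = - 5 G / L\<close> and \<open>d/df (G / L) = 2 b\<close>, so that \<open>d/df (P dL/df) = - 10 b = - (f - 3) L\<close>: this is the
  differential equation, multiplied by \<open>P\<close>.
\<close>

section \<open>Lambert series\<close>

text \<open>
  Termwise differentiation of a power series keeps its radius of convergence and multiplies the \<open>n\<close>-th
  coefficient by a factor \<open>n\<close>, which gives the induction on \<open>m\<close>.
\<close>

lemma summable_pow_geometric:
  fixes s :: real
  assumes "0 \<le> s" "s < 1"
  shows "summable (\<lambda>n. real (Suc n) ^ m * s ^ Suc n)"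
proof -
  have "\<forall>x::real. norm x < 1 \<longrightarrow> summable (\<lambda>n. real (Suc n) ^ m * x ^ n)"
  proof (induction m)
    case 0
    then show ?case by (auto intro: summable_geometric)
  next
    case (Suc m)
    have *: "summable (\<lambda>n. real n ^ m * x ^ n)" if "norm x < 1" for x :: real
    proof -
      have "summable (\<lambda>n. x * (real (Suc n) ^ m * x ^ n))"
        using Suc that by (intro summable_mult) auto
      then have "summable (\<lambda>n. (\<lambda>n. real n ^ m * x ^ n) (Suc n))"
        by (simp add: mult_ac)
      then show ?thesis by (subst (asm) summable_Suc_iff)
    qed
    show ?case
    proof (intro allI impI)
      fix x :: real assume "norm x < 1"
      then have "summable (\<lambda>n. diffs (\<lambda>n. real n ^ m) n * x ^ n)"
        by (rule termdiff_converges) (use * in auto)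
      then show "summable (\<lambda>n. real (Suc n) ^ Suc m * x ^ n)"
        by (simp add: diffs_def)
    qed
  qed
  then have "summable (\<lambda>n. real (Suc n) ^ m * s ^ n)" using assms by auto
  then have "summable (\<lambda>n. s * (real (Suc n) ^ m * s ^ n))" by (rule summable_mult)
  then show ?thesis by (simp add: mult_ac)
qed

text \<open>
  The weight \<open>k\<close> is an integer: \<open>k = -1\<close> is needed for the logarithms of the infinite products.
\<close>

definition lambert_term :: "nat \<Rightarrow> int \<Rightarrow> complex \<Rightarrow> complex \<Rightarrow> nat \<Rightarrow> complex" where
  "lambert_term j k q x n =
     of_nat (Suc n) powi k * (q ^ Suc n / (1 - q ^ Suc n) ^ j) * x ^ Suc n"

definition lambert :: "nat \<Rightarrow> int \<Rightarrow> complex \<Rightarrow> complex \<Rightarrow> complex" where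
  "lambert j k q x = (\<Sum>n. lambert_term j k q x n)"

lemma one_minus_power_bound:
  fixes q :: complex
  assumes "norm q \<le> r" "r < 1"
  shows "1 - r \<le> norm (1 - q ^ Suc n)"
proof -
  have "norm (q ^ Suc n) \<le> norm q ^ 1"
    unfolding norm_power using assms by (intro power_decreasing) auto
  then have "norm (q ^ Suc n) \<le> r" using assms by auto
  moreover have "norm (1::complex) - norm (q ^ Suc n) \<le> norm (1 - q ^ Suc n)"
    by (rule norm_triangle_ineq2)
  ultimately show ?thesis by simp
qed

lemma one_minus_power_nonzero:
  fixes q :: complex
  assumes "norm q < 1"
  shows "1 - q ^ Suc n \<noteq> 0"
  using one_minus_power_bound[of q "norm q" n] assms by force

lemma lambert_term_bound:
  assumes "norm q \<le> r" "r < 1" "norm (q * x) \<le> s" "s < 1"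
  shows "norm (lambert_term j k q x n) \<le> real (Suc n) ^ nat \<bar>k\<bar> * s ^ Suc n / (1 - r) ^ j"
proof -
  have k: "norm (of_nat (Suc n) powi k :: complex) \<le> real (Suc n) ^ nat \<bar>k\<bar>"
  proof (cases "k \<ge> 0")
    case True
    then show ?thesis by (simp add: power_int_def norm_power del: of_nat_Suc)
  next
    case False
    have "norm (of_nat (Suc n) powi k :: complex) = inverse (real (Suc n) ^ nat \<bar>k\<bar>)"
      using False by (simp add: power_int_def norm_power norm_inverse power_inverse del: of_nat_Suc)
    also have "\<dots> \<le> 1" by (rule inverse_le_1_iff[THEN iffD2]) (simp add: one_le_power del: of_nat_Suc)
    also have "\<dots> \<le> real (Suc n) ^ nat \<bar>k\<bar>" by (rule one_le_power) simp
    finally show ?thesis .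
  qed
  have d: "(1 - r) ^ j \<le> norm ((1 - q ^ Suc n) ^ j)"
    unfolding norm_power using one_minus_power_bound[OF assms(1,2), of n] assms(2)
    by (intro power_mono) auto
  have "lambert_term j k q x n = of_nat (Suc n) powi k * (q * x) ^ Suc n / (1 - q ^ Suc n) ^ j"
    by (simp only: lambert_term_def power_mult_distrib) simp
  then have "norm (lambert_term j k q x n) =
     norm (of_nat (Suc n) powi k :: complex) * norm (q * x) ^ Suc n / norm ((1 - q ^ Suc n) ^ j)"
    by (simp only: norm_mult norm_divide norm_power)
  also have "\<dots> \<le> real (Suc n) ^ nat \<bar>k\<bar> * s ^ Suc n / (1 - r) ^ j"
    using assms k d norm_ge_zero[of "q * x"] order_trans[OF norm_ge_zero assms(3)]
    by (intro frac_le mult_mono power_mono) (auto simp del: power_Suc norm_mult of_nat_Suc)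
  finally show ?thesis .
qed

lemma lambert_bound_summable:
  assumes "0 \<le> s" "s < (1::real)"
  shows "summable (\<lambda>n. real (Suc n) ^ m * s ^ Suc n / (1 - r) ^ j)"
  using summable_divide[OF summable_pow_geometric[OF assms, of m]] .

lemma lambert_summable_norm:
  assumes "norm q < 1" "norm (q * x) < 1"
  shows "summable (\<lambda>n. norm (lambert_term j k q x n))"
  by (rule summable_comparison_test'[OF lambert_bound_summable[of "norm (q*x)" "nat \<bar>k\<bar>" "norm q" j]])
     (use assms lambert_term_bound[of q "norm q" x "norm (q*x)" j k] in \<open>auto simp del: power_Suc\<close>)

lemma lambert_sums:
  assumes "norm q < 1" "norm (q * x) < 1"
  shows "lambert_term j k q x sums lambert j k q x"
  unfolding lambert_def
  using summable_norm_cancel[OF lambert_summable_norm[OF assms]] by (rule summable_sums)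

lemma lambert_deriv_x:
  assumes "norm q < 1" "norm (q * x) < 1" "x \<noteq> 0"
  shows "((\<lambda>x. lambert j k q x) has_field_derivative lambert j (k + 1) q x / x) (at x)"
proof -
  define s where "s = (1 + norm (q * x)) / 2"
  have s: "0 \<le> s" "norm (q * x) < s" "s < 1" using assms by (auto simp: s_def)
  define S where "S = {y. norm (q * y) < s} - {0}"
  have op: "open S" unfolding S_def
    by (intro open_Diff open_Collect_less continuous_intros)
  have xS: "x \<in> S" using s assms by (auto simp: S_def)
  have d: "((\<lambda>y. lambert_term j k q y n) has_field_derivative lambert_term j (k+1) q y n / y) (at y)"
    if "y \<in> S" for n y
  proof -
    have y: "y \<noteq> 0" using that by (simp add: S_def)
    have "((\<lambda>y. of_nat (Suc n) powi k * (q ^ Suc n / (1 - q ^ Suc n) ^ j) * y ^ Suc n) has_field_derivative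
        of_nat (Suc n) powi k * (q ^ Suc n / (1 - q ^ Suc n) ^ j) * (of_nat (Suc n) * y ^ n)) (at y)"
      by (intro DERIV_cmult) (rule derivative_eq_intros refl | simp)+
    moreover have "of_nat (Suc n) powi k * (q ^ Suc n / (1 - q ^ Suc n) ^ j) * (of_nat (Suc n) * y ^ n)
        = lambert_term j (k+1) q y n / y"
      unfolding lambert_term_def using y by (subst power_int_add) (auto simp: mult_ac simp del: of_nat_Suc)
    ultimately show ?thesis unfolding lambert_term_def by metis
  qed
  obtain g g' where gg: "\<forall>y\<in>S. ((\<lambda>n. lambert_term j k q y n) sums g y) \<and>
      ((\<lambda>n. lambert_term j (k+1) q y n / y) sums g' y) \<and> (g has_field_derivative g' y) (at y)"
  proof (rule series_and_derivative_comparison[OF op lambert_bound_summable[OF s(1,3), of "nat \<bar>k\<bar>" "norm q" j] d])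
    show "\<forall>\<^sub>F n in sequentially. \<forall>y\<in>S. norm (lambert_term j k q y n)
             \<le> real (Suc n) ^ nat \<bar>k\<bar> * s ^ Suc n / (1 - norm q) ^ j"
      by (intro always_eventually allI ballI lambert_term_bound)
         (use assms s in \<open>auto simp: S_def\<close>)
  qed auto
  have "g' x = lambert j (k+1) q x / x"
    using gg xS sums_divide[OF lambert_sums[OF assms(1,2), of j "k+1"], of x] sums_unique2 by blast
  moreover have "g y = lambert j k q y" if "y \<in> S" for y
    using gg that lambert_def sums_unique by metis
  ultimately show ?thesis
    using gg xS op by (metis (no_types, lifting) has_field_derivative_transform_within_open)
qed

text \<open>
  The operator \<open>q d/dq\<close> sends \<open>q^n / (1 - q^n)\<close> to \<open>n q^n / (1 - q^n)\<^sup>2\<close>. The value of the derivative at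
  \<open>q = 0\<close>, which the equation for \<open>q * d\<close> leaves open, is the first coefficient of the series.
\<close>

lemma lambert_deriv_q:
  assumes "norm q < 1" "norm (q * x) < 1"
  shows "\<exists>d. ((\<lambda>q. lambert 1 k q x) has_field_derivative d) (at q) \<and>
             q * d = lambert 2 (k + 1) q x \<and> (q = 0 \<longrightarrow> d = x)"
proof -
  define s where "s = (1 + norm (q * x)) / 2"
  have s: "0 \<le> s" "norm (q * x) < s" "s < 1" using assms by (auto simp: s_def)
  define r where "r = (1 + norm q) / 2"
  have r: "norm q < r" "r < 1" using assms by (auto simp: r_def)
  define S where "S = {p. norm (p * x) < s} \<inter> {p. norm p < r}"
  have op: "open S" unfolding S_def
    by (intro open_Int open_Collect_less continuous_intros)
  have xS: "q \<in> S" using s r assms by (auto simp: S_def)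
  define f' where "f' = (\<lambda>n p. of_nat (Suc n) powi (k+1) * (p ^ n / (1 - p ^ Suc n) ^ 2) * x ^ Suc n)"
  have d: "((\<lambda>p. lambert_term 1 k p x n) has_field_derivative f' n p) (at p)"
    if "p \<in> S" for n p
  proof -
    have nz: "1 - p ^ Suc n \<noteq> 0" using that r by (intro one_minus_power_nonzero) (auto simp: S_def)
    have "((\<lambda>p. p ^ Suc n / (1 - p ^ Suc n)) has_field_derivative
            of_nat (Suc n) * p ^ n / (1 - p ^ Suc n) ^ 2) (at p)"
      by (rule derivative_eq_intros refl nz)+ (use nz in \<open>simp add: field_simps power2_eq_square del: of_nat_Suc\<close>)
    then have "((\<lambda>p. of_nat (Suc n) powi k * (p ^ Suc n / (1 - p ^ Suc n)) * x ^ Suc n) has_field_derivative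
       of_nat (Suc n) powi k * (of_nat (Suc n) * p ^ n / (1 - p ^ Suc n) ^ 2) * x ^ Suc n) (at p)"
      by (intro DERIV_cmult DERIV_cmult_right)
    moreover have "of_nat (Suc n) powi k * (of_nat (Suc n) * p ^ n / (1 - p ^ Suc n) ^ 2) * x ^ Suc n = f' n p"
      unfolding f'_def by (subst power_int_add) (auto simp: mult_ac simp del: of_nat_Suc)
    ultimately show ?thesis unfolding lambert_term_def power_one_right by metis
  qed
  obtain g g' where gg: "\<forall>p\<in>S. ((\<lambda>n. lambert_term 1 k p x n) sums g p) \<and>
      ((\<lambda>n. f' n p) sums g' p) \<and> (g has_field_derivative g' p) (at p)"
  proof (rule series_and_derivative_comparison[OF op lambert_bound_summable[OF s(1,3), of "nat \<bar>k\<bar>" r 1] d])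
    show "\<forall>\<^sub>F n in sequentially. \<forall>p\<in>S. norm (lambert_term 1 k p x n)
             \<le> real (Suc n) ^ nat \<bar>k\<bar> * s ^ Suc n / (1 - r) ^ 1"
      by (intro always_eventually allI ballI lambert_term_bound)
         (use assms s r in \<open>auto simp: S_def\<close>)
  qed auto
  have "(\<lambda>n. q * f' n q) sums (q * g' q)" using gg xS sums_mult by blast
  moreover have "(\<lambda>n. q * f' n q) = lambert_term 2 (k+1) q x"
    by (auto simp: f'_def lambert_term_def fun_eq_iff mult_ac simp del: of_nat_Suc)
  ultimately have "q * g' q = lambert 2 (k+1) q x"
    using lambert_sums[OF assms] sums_unique2 by metis
  moreover have "g' q = x" if "q = 0"
  proof -
    have "f' n q = (if n = 0 then x else 0)" for n
      using that by (cases n) (auto simp: f'_def)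
    then have "(\<lambda>n. f' n q) sums x" using sums_single[of 0 "\<lambda>_. x"] by simp
    moreover have "(\<lambda>n. f' n q) sums g' q" using gg xS by blast
    ultimately show ?thesis by (rule sums_unique2[symmetric])
  qed
  moreover have "g p = lambert 1 k p x" if "p \<in> S" for p
    using gg that lambert_def sums_unique by metis
  ultimately show ?thesis
    using gg xS op by (metis (no_types, lifting) has_field_derivative_transform_within_open)
qed

section \<open>The addition theorem\<close>

lemma has_sum_times:
  fixes f :: "'a \<Rightarrow> complex" and g :: "'b \<Rightarrow> complex"
  assumes f: "(f has_sum a) UNIV" "(\<lambda>m. norm (f m)) summable_on UNIV"
      and g: "(g has_sum b) UNIV" "(\<lambda>m. norm (g m)) summable_on UNIV"
  shows "((\<lambda>(m, n). f m * g n) has_sum a * b) UNIV"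
proof -
  have "(\<lambda>p. norm (case p of (m, n) \<Rightarrow> f m * g n)) summable_on UNIV \<times> UNIV"
  proof (subst Infinite_Sum.abs_summable_on_Sigma_iff, intro conjI ballI)
    show "(\<lambda>n. norm (case (m, n) of (m, n) \<Rightarrow> f m * g n)) summable_on UNIV" for m
      using g(2) by (auto simp: norm_mult intro: summable_on_cmult_right)
    have "(\<lambda>m. norm (f m) * (\<Sum>\<^sub>\<infinity>n. norm (g n))) summable_on UNIV"
      using f(2) by (rule summable_on_cmult_left)
    then have "(\<lambda>m. norm (norm (f m) * (\<Sum>\<^sub>\<infinity>n. norm (g n)))) summable_on UNIV"
      by (subst (asm) summable_on_iff_abs_summable_on_real)
    then show "(\<lambda>m. norm (\<Sum>\<^sub>\<infinity>n. norm (case (m, n) of (m, n) \<Rightarrow> f m * g n))) summable_on UNIV"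
      by (simp add: norm_mult infsum_cmult_right')
  qed
  then have s: "(\<lambda>(m, n). f m * g n) summable_on UNIV \<times> UNIV"
    by (rule Infinite_Sum.abs_summable_summable)
  have "((\<lambda>(m, n). f m * g n) has_sum a * b) (UNIV \<times> UNIV)"
    by (rule has_sum_SigmaI[OF _ _ s, where g = "\<lambda>m. f m * b"])
       (use f g in \<open>auto intro: has_sum_cmult_right has_sum_cmult_left\<close>)
  then show ?thesis by simp
qed

text \<open>
  Bilateral sums are treated as unconditional sums over the integers, because the proof of the addition
  theorem substitutes indices in double sums.
\<close>

lemma bilateral_has_sum:
  fixes f :: "int \<Rightarrow> complex"
  assumes p: "summable (\<lambda>n. norm (f (int (Suc n))))" "(\<lambda>n. f (int (Suc n))) sums a"
      and m: "summable (\<lambda>n. norm (f (- int (Suc n))))" "(\<lambda>n. f (- int (Suc n))) sums b"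
  shows "(f has_sum (f 0 + a + b)) UNIV" "(\<lambda>m. norm (f m)) summable_on UNIV"
proof -
  have un: "UNIV = ({0} \<union> range (\<lambda>n. int (Suc n))) \<union> range (\<lambda>n. - int (Suc n))"
  proof -
    have "i \<in> ({0} \<union> range (\<lambda>n. int (Suc n))) \<union> range (\<lambda>n. - int (Suc n))" for i
    proof (cases i)
      case (nonneg n)
      then show ?thesis by (cases n) auto
    next
      case (neg n)
      then show ?thesis by auto
    qed
    then show ?thesis by auto
  qed
  have inj: "inj (\<lambda>n. int (Suc n))" "inj (\<lambda>n. - int (Suc n))" by (auto simp: inj_def)
  have 1: "(f has_sum a) (range (\<lambda>n. int (Suc n)))"
    unfolding has_sum_reindex[OF inj(1)] o_def by (rule norm_summable_imp_has_sum[OF p])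
  have 2: "(f has_sum b) (range (\<lambda>n. - int (Suc n)))"
    unfolding has_sum_reindex[OF inj(2)] o_def by (rule norm_summable_imp_has_sum[OF m])
  have 0: "(f has_sum (f 0)) {0}" by (rule has_sum_finiteI) auto
  show "(f has_sum (f 0 + a + b)) UNIV"
    unfolding un by (intro has_sum_Un_disjoint 0 1 2) auto
  have 1: "(\<lambda>m. norm (f m)) summable_on (range (\<lambda>n. int (Suc n)))"
    unfolding summable_on_reindex[OF inj(1)] o_def
    by (rule norm_summable_imp_summable_on) (use p in simp)
  have 2: "(\<lambda>m. norm (f m)) summable_on (range (\<lambda>n. - int (Suc n)))"
    unfolding summable_on_reindex[OF inj(2)] o_def
    by (rule norm_summable_imp_summable_on) (use m in simp)
  show "(\<lambda>m. norm (f m)) summable_on UNIV"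
    unfolding un by (intro summable_on_Un_disjoint 1 2 summable_on_finite) auto
qed

definition annulus :: "complex \<Rightarrow> complex set" where
  "annulus q = {x. norm q < norm x \<and> norm (q * x) < 1}"

text \<open>
  Minus the logarithmic derivative under \<open>x d/dx\<close> of the theta function
  \<open>(x\<^sup>1\<^sup>/\<^sup>2 - x\<^sup>-\<^sup>1\<^sup>/\<^sup>2) \<Prod>(1 - x q^n) (1 - q^n / x)\<close>; it is the Weierstrass zeta function up to scaling and a
  multiple of \<open>log x\<close>.
\<close>

definition rho :: "complex \<Rightarrow> complex \<Rightarrow> complex" where
  "rho q x = (1 + x) / (2 * (1 - x)) + (lambert 1 0 q x - lambert 1 0 q (inverse x))"

text \<open>
  Minus the logarithmic derivative under \<open>q d/dq\<close> of the same theta function.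
\<close>

definition wp :: "complex \<Rightarrow> complex \<Rightarrow> complex" where
  "wp q x = lambert 2 0 q x + lambert 2 0 q (inverse x)"

lemma annulusD:
  assumes "x \<in> annulus q"
  shows "x \<noteq> 0" "norm (q * x) < 1" "norm (q * inverse x) < 1"
proof -
  show x: "x \<noteq> 0" "norm (q * x) < 1" using assms by (auto simp: annulus_def)
  show "norm (q * inverse x) < 1"
    using assms x by (auto simp: annulus_def norm_divide divide_inverse[symmetric] divide_less_eq)
qed

text \<open>
  Coefficients of \<open>rho q\<close> as a bilateral series in \<open>x\<close>. The value at \<open>0\<close> makes
  \<open>alpha q (- m) = 1 - alpha q m\<close> hold without exception.
\<close>

definition alpha :: "complex \<Rightarrow> int \<Rightarrow> complex" where
  "alpha q m = (if m = 0 then 1 / 2 else 1 / (1 - q powi m))"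

definition beta :: "complex \<Rightarrow> int \<Rightarrow> complex" where
  "beta q m = (if m = 0 then 0 else q powi m / (1 - q powi m) ^ 2)"

lemma power_int_Suc_nat: "x powi (int (Suc n)) = x ^ Suc n" "x powi (- int (Suc n)) = inverse x ^ Suc n"
   for x :: complex
  by (simp_all add: power_int_def power_inverse nat_add_distrib del: of_nat_Suc)

lemma alpha_neg: 
  assumes "q \<noteq> 0" "norm q < 1"
  shows "alpha q (- int (Suc n)) = - (q ^ Suc n / (1 - q ^ Suc n))"
proof -
  have nz: "1 - q ^ Suc n \<noteq> 0" using assms by (intro one_minus_power_nonzero)
  have "alpha q (- int (Suc n)) = 1 / (1 - inverse (q ^ Suc n))"
    by (simp only: alpha_def power_int_Suc_nat power_inverse) simp
  also have "\<dots> = - (q ^ Suc n / (1 - q ^ Suc n))"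
  proof -
    define u where "u = q ^ Suc n"
    have "u \<noteq> 0" "1 - u \<noteq> 0" using nz assms by (auto simp: u_def)
    then have "1 / (1 - inverse u) = - (u / (1 - u))"
      by (auto simp: divide_simps) (auto simp: algebra_simps)
    then show ?thesis by (simp add: u_def)
  qed
  finally show ?thesis .
qed

lemma beta_neg:
  assumes "q \<noteq> 0" "norm q < 1"
  shows "beta q (- int (Suc n)) = beta q (int (Suc n))"
proof -
  have nz: "1 - q ^ Suc n \<noteq> 0" using assms by (intro one_minus_power_nonzero)
  define u where "u = q ^ Suc n"
  have u: "u \<noteq> 0" "1 - u \<noteq> 0" using nz assms by (auto simp: u_def)
  have "beta q (- int (Suc n)) = inverse u / (1 - inverse u)\<^sup>2"
    by (simp only: beta_def power_int_Suc_nat power_inverse u_def) simp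
  also have "1 - inverse u = - (1 - u) * inverse u" using u by (simp add: field_simps)
  also have "inverse u / (- (1 - u) * inverse u)\<^sup>2 = u / (1 - u)\<^sup>2"
    using u by (simp add: field_simps power2_eq_square)
  also have "\<dots> = beta q (int (Suc n))"
    by (simp only: beta_def power_int_Suc_nat u_def) simp
  finally show ?thesis .
qed

lemma annulusI:
  assumes "norm q < 1" "norm q < norm x" "norm x < 1"
  shows "x \<in> annulus q"
proof -
  have "norm q * norm x \<le> 1 * norm x" using assms by (intro mult_right_mono) auto
  then show ?thesis using assms by (auto simp: annulus_def norm_mult)
qed

text \<open>
  For \<open>norm x < 1\<close> the rational part of \<open>rho\<close> is \<open>1/2 + \<Sum>x^n\<close>; it turns the coefficient
  \<open>q^n / (1 - q^n)\<close> into \<open>1 / (1 - q^n)\<close>, which makes the coefficients of positive and negative index uniform.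
\<close>

lemma rho_bilateral:
  assumes q: "q \<noteq> 0" "norm q < 1" and x: "norm q < norm x" "norm x < 1"
  shows "((\<lambda>m. alpha q m * x powi m) has_sum rho q x) UNIV"
        "(\<lambda>m. norm (alpha q m * x powi m)) summable_on UNIV"
proof -
  have an: "x \<in> annulus q" using q x by (intro annulusI)
  note [simp del] = power_Suc of_nat_Suc
  have pos: "alpha q (int (Suc n)) * x powi (int (Suc n)) = x ^ Suc n + lambert_term 1 0 q x n" for n
  proof -
    have nz: "1 - q ^ Suc n \<noteq> 0" using q by (intro one_minus_power_nonzero)
    have "alpha q (int (Suc n)) = 1 / (1 - q ^ Suc n)"
      by (simp only: alpha_def power_int_Suc_nat) simp
    also have "\<dots> = 1 + q ^ Suc n / (1 - q ^ Suc n)" using nz by (simp add: field_simps)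
    finally show ?thesis by (simp only: power_int_Suc_nat lambert_term_def) (simp add: algebra_simps)
  qed
  have neg: "alpha q (- int (Suc n)) * x powi (- int (Suc n)) = - lambert_term 1 0 q (inverse x) n" for n
    by (simp only: power_int_Suc_nat lambert_term_def alpha_neg[OF q]) simp
  have geo: "(\<lambda>n. x ^ Suc n) sums (x / (1 - x))"
    using sums_mult[OF geometric_sums[OF x(2)], of x] by (simp add: power_Suc)
  have geo': "summable (\<lambda>n. norm (x ^ Suc n))"
    unfolding norm_power using x(2) by (subst summable_Suc_iff) (auto intro: summable_geometric)
  note ls = lambert_summable_norm[OF q(2) annulusD(2)[OF an]] lambert_summable_norm[OF q(2) annulusD(3)[OF an]]
  have 1: "(\<lambda>n. alpha q (int (Suc n)) * x powi (int (Suc n))) sums (x / (1 - x) + lambert 1 0 q x)"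
    unfolding pos by (intro sums_add geo lambert_sums q annulusD(2)[OF an])
  have 2: "(\<lambda>n. alpha q (- int (Suc n)) * x powi (- int (Suc n))) sums (- lambert 1 0 q (inverse x))"
    unfolding neg by (intro sums_minus lambert_sums q annulusD(3)[OF an])
  have 3: "summable (\<lambda>n. norm (alpha q (int (Suc n)) * x powi (int (Suc n))))"
    unfolding pos
    by (rule summable_comparison_test'[OF summable_add[OF geo' ls(1)[of 1 0]]])
       (auto intro: norm_triangle_ineq)
  have 4: "summable (\<lambda>n. norm (alpha q (- int (Suc n)) * x powi (- int (Suc n))))"
    unfolding neg norm_minus_cancel by (rule ls)
  have "x \<noteq> 1" using x by auto
  then have "alpha q 0 * x powi 0 + (x / (1 - x) + lambert 1 0 q x) + (- lambert 1 0 q (inverse x)) = rho q x"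
    by (simp add: rho_def alpha_def divide_simps) (simp add: algebra_simps)
  then show "((\<lambda>m. alpha q m * x powi m) has_sum rho q x) UNIV"
    using bilateral_has_sum(1)[of "\<lambda>m. alpha q m * x powi m", OF 3 1 4 2] by simp
  show "(\<lambda>m. norm (alpha q m * x powi m)) summable_on UNIV"
    using bilateral_has_sum(2)[of "\<lambda>m. alpha q m * x powi m", OF 3 1 4 2] .
qed

lemma wp_bilateral:
  assumes q: "q \<noteq> 0" "norm q < 1" and x: "x \<in> annulus q"
  shows "((\<lambda>m. beta q m * x powi m) has_sum wp q x) UNIV"
proof -
  have pos: "beta q (int (Suc n)) * x powi (int (Suc n)) = lambert_term 2 0 q x n" for n
    by (simp only: power_int_Suc_nat lambert_term_def beta_def) simp
  have neg: "beta q (- int (Suc n)) * x powi (- int (Suc n)) = lambert_term 2 0 q (inverse x) n" for n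
    by (simp only: beta_neg[OF q]) (simp only: power_int_Suc_nat lambert_term_def beta_def, simp)
  show ?thesis
    using bilateral_has_sum(1)[of "\<lambda>m. beta q m * x powi m" "lambert 2 0 q x" "lambert 2 0 q (inverse x)"]
    unfolding pos neg
    by (auto simp: wp_def beta_def[of _ 0] intro!: lambert_summable_norm lambert_sums q annulusD(2,3) x)
qed

text \<open>
  The coefficient of \<open>x^m y^n\<close> in \<open>rho q x * rho q y - (rho q x + rho q y) * rho q (x * y)\<close>.
\<close>

definition addition_coeff :: "complex \<Rightarrow> int \<Rightarrow> int \<Rightarrow> complex" where
  "addition_coeff q m n = alpha q m * alpha q n - alpha q (m - n) * alpha q n - alpha q m * alpha q (n - m)"

lemma power_int_neq_1:
  assumes q: "q \<noteq> 0" "norm q < (1::real)" and "m \<noteq> 0"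
  shows "(q::complex) powi m \<noteq> 1"
proof
  assume *: "q powi m = 1"
  have "1 - q ^ Suc (nat \<bar>m\<bar> - 1) \<noteq> 0" using q by (intro one_minus_power_nonzero)
  then have "q ^ nat \<bar>m\<bar> \<noteq> 1" using assms(3) by (simp del: power_Suc)
  moreover have "q ^ nat \<bar>m\<bar> = q powi m \<or> q ^ nat \<bar>m\<bar> = inverse (q powi m)"
    by (auto simp: power_int_def power_inverse)
  ultimately show False using * by auto
qed

lemma alpha_minus:
  assumes q: "q \<noteq> 0" "norm q < 1"
  shows "alpha q (- m) = 1 - alpha q m"
proof (cases "m = 0")
  case False
  then show ?thesis using q power_int_neq_1[OF q False]
    by (auto simp: alpha_def power_int_minus divide_simps) (auto simp: algebra_simps)
qed (simp add: alpha_def)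

lemma alpha_sq:
  assumes q: "q \<noteq> 0" "norm q < 1" and "m \<noteq> 0"
  shows "alpha q m ^ 2 - alpha q m = beta q m"
  using power_int_neq_1[OF assms] assms(3)
  by (simp add: alpha_def beta_def divide_simps power2_eq_square)

text \<open>
  For \<open>u = q^k\<close> and \<open>v = q^n\<close> the partial fraction identity
  \<open>1 / ((1 - u) (1 - v)) = (1 / (1 - u) + 1 / (1 - v) - 1) / (1 - u v)\<close> makes every coefficient cancel except on
  the three lines \<open>m = 0\<close>, \<open>n = 0\<close> and \<open>m = n\<close>, and on these the bilateral series of \<open>wp\<close> remain.
\<close>

lemma addition_coeff_eq:
  assumes q: "q \<noteq> 0" "norm q < 1"
  shows "addition_coeff q m n = (if m = 0 \<and> n = 0 then -1/4 else 0) + (if n = 0 then beta q m else 0)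
     + (if m = 0 then beta q n else 0) + (if m = n then beta q m else 0)"
proof -
  consider "m = 0" "n = 0" | "m \<noteq> 0" "n = 0" | "m = 0" "n \<noteq> 0" | "m \<noteq> 0" "n = m"
    | "m \<noteq> 0" "n \<noteq> 0" "m \<noteq> n" by blast
  then show ?thesis
  proof cases
    case 1
    then show ?thesis by (simp add: addition_coeff_def alpha_def beta_def)
  next
    case 2
    then have "addition_coeff q m n = alpha q m ^ 2 - alpha q m"
      by (simp add: addition_coeff_def alpha_minus[OF q] alpha_def[of _ 0] power2_eq_square algebra_simps)
    then show ?thesis using 2 alpha_sq[OF q, of m] by simp
  next
    case 3
    then have "addition_coeff q m n = alpha q n ^ 2 - alpha q n"
      by (simp add: addition_coeff_def alpha_minus[OF q] alpha_def[of _ 0] power2_eq_square algebra_simps)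
    then show ?thesis using 3 alpha_sq[OF q, of n] by simp
  next
    case 4
    then have "addition_coeff q m n = alpha q m ^ 2 - alpha q m"
      by (simp add: addition_coeff_def alpha_def[of _ 0] power2_eq_square)
    then show ?thesis using 4 alpha_sq[OF q, of m] by simp
  next
    case 5
    define k where "k = m - n"
    have k: "k \<noteq> 0" "m = k + n" using 5 by (auto simp: k_def)
    have a: "alpha q (n - m) = 1 - alpha q k" using alpha_minus[OF q, of k] by (simp add: k_def)
    define u v where "u = q powi k" and "v = q powi n"
    have uv: "1 - u \<noteq> 0" "1 - v \<noteq> 0" "1 - u * v \<noteq> 0" "q powi m = u * v"
      using power_int_neq_1[OF q, of m] power_int_neq_1[OF q, of n] power_int_neq_1[OF q, of k] 5 k q
      by (auto simp: u_def v_def power_int_add)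
    have al: "alpha q k = 1 / (1 - u)" "alpha q n = 1 / (1 - v)" "alpha q m = 1 / (1 - u * v)"
      using k 5 uv by (auto simp: alpha_def u_def v_def)
    have "addition_coeff q m n = alpha q m * alpha q k + alpha q m * alpha q n - alpha q m - alpha q k * alpha q n"
      unfolding addition_coeff_def a k_def[symmetric] by (simp add: algebra_simps)
    also have "\<dots> = 0" unfolding al using uv(1-3)
      by (simp add: divide_simps) (simp add: algebra_simps)
    finally show ?thesis using 5 by simp
  qed
qed

lemma has_sum_diagonal_support:
  fixes F :: "int \<times> int \<Rightarrow> complex"
  assumes "(g has_sum S) UNIV" "inj h" "\<And>p. p \<notin> range h \<Longrightarrow> F p = 0" "\<And>m. F (h m) = g m"
  shows "(F has_sum S) UNIV"
proof -
  have "((F \<circ> h) has_sum S) UNIV" using assms(1,4) by (simp add: o_def)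
  then have "(F has_sum S) (range h)" using assms(2) by (simp add: has_sum_reindex)
  then show ?thesis
    by (subst (asm) has_sum_cong_neutral[of UNIV _ F]) (use assms(3) in auto)
qed

lemma has_sum_diff:
  fixes f g :: "'a \<Rightarrow> complex"
  assumes "(f has_sum a) A" "(g has_sum b) A"
  shows "((\<lambda>x. f x - g x) has_sum (a - b)) A"
  using has_sum_add[OF assms(1), of "\<lambda>x. - g x" "- b"] assms(2) by (simp add: has_sum_uminus)

text \<open>
  In this region all three arguments lie in the annulus where \<open>rho\<close> has its bilateral expansion, so the
  products are absolutely convergent double series and may be compared coefficient by coefficient.
\<close>

lemma addition_inner:
  assumes q: "q \<noteq> 0" "norm q < 1"
    and x: "norm x < 1" and y: "norm y < 1" and xy: "norm q < norm (x * y)"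
  shows "rho q x * rho q y - rho q x * rho q (x * y) - rho q y * rho q (x * y)
         = - 1 / 4 + wp q x + wp q y + wp q (x * y)"
proof -
  have x': "norm q < norm x" using xy y mult_left_mono[of "norm y" 1 "norm x"] by (auto simp: norm_mult)
  have y': "norm q < norm y" using xy x mult_right_mono[of "norm x" 1 "norm y"] by (auto simp: norm_mult)
  have xy': "norm (x * y) < 1" using x y mult_strict_mono[of "norm x" 1 "norm y" 1] by (auto simp: norm_mult)
  have nz: "x \<noteq> 0" "y \<noteq> 0" using x' y' by auto
  have an: "x \<in> annulus q" "y \<in> annulus q" "x * y \<in> annulus q"
    using x x' y y' xy xy' q by (intro annulusI; simp)+
  let ?A = "\<lambda>x m. alpha q m * x powi m"
  note X = rho_bilateral[OF q x' x] and Y = rho_bilateral[OF q y' y] and XY = rho_bilateral[OF q xy xy']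
  have pw: "x powi (m + n) = x powi m * x powi n" "y powi (m + n) = y powi m * y powi n" for m n
    using nz by (simp_all add: power_int_add)
  have 1: "((\<lambda>(m, n). alpha q m * alpha q n * (x powi m * y powi n)) has_sum rho q x * rho q y) UNIV"
    using has_sum_times[OF X Y] by (simp add: case_prod_unfold mult_ac)
  \<comment> \<open>The products with \<open>rho q (x * y)\<close> are re-indexed so that every series has \<open>x^m y^n\<close> as its general term.\<close>
  have 2: "((\<lambda>(m, n). alpha q (m - n) * alpha q n * (x powi m * y powi n)) has_sum rho q x * rho q (x * y)) UNIV"
  proof -
    have "((\<lambda>(m, n). ?A x m * ?A (x * y) n) has_sum rho q x * rho q (x * y)) UNIV \<longleftrightarrow> ?thesis"
      by (rule has_sum_reindex_bij_witness[of _ "\<lambda>(m, n). (m - n, n)" "\<lambda>(m, n). (m + n, n)"])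
         (auto simp: pw power_int_mult_distrib)
    then show ?thesis using has_sum_times[OF X XY] by simp
  qed
  have 3: "((\<lambda>(m, n). alpha q m * alpha q (n - m) * (x powi m * y powi n)) has_sum rho q y * rho q (x * y)) UNIV"
  proof -
    have "((\<lambda>(m, n). ?A y m * ?A (x * y) n) has_sum rho q y * rho q (x * y)) UNIV \<longleftrightarrow> ?thesis"
      by (rule has_sum_reindex_bij_witness[of _ "\<lambda>(m, n). (n - m, m)" "\<lambda>(m, n). (n, m + n)"])
         (auto simp: pw power_int_mult_distrib)
    then show ?thesis using has_sum_times[OF Y XY] by simp
  qed
  have L: "((\<lambda>(m, n). addition_coeff q m n * (x powi m * y powi n)) has_sum
       (rho q x * rho q y - rho q x * rho q (x * y) - rho q y * rho q (x * y))) UNIV"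
    using has_sum_diff[OF has_sum_diff[OF 1 2] 3]
    unfolding addition_coeff_def by (simp only: case_prod_unfold left_diff_distrib)
  have c: "((\<lambda>(m, n). (if m = 0 \<and> n = 0 then -1/4 else 0) * (x powi m * y powi n)) has_sum (-1/4)) UNIV"
    by (rule has_sum_finite_neutralI[of "{(0,0)}"]) (auto split: if_splits)
  have bx: "((\<lambda>(m, n). (if n = 0 then beta q m else 0) * (x powi m * y powi n)) has_sum wp q x) UNIV"
    by (rule has_sum_diagonal_support[OF wp_bilateral[OF q an(1)], of "\<lambda>m. (m, 0)"]) (auto simp: inj_def image_iff split: if_splits)
  have by0: "((\<lambda>(m, n). (if m = 0 then beta q n else 0) * (x powi m * y powi n)) has_sum wp q y) UNIV"
    by (rule has_sum_diagonal_support[OF wp_bilateral[OF q an(2)], of "\<lambda>m. (0, m)"]) (auto simp: inj_def image_iff split: if_splits)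
  have bxy: "((\<lambda>(m, n). (if m = n then beta q m else 0) * (x powi m * y powi n)) has_sum wp q (x * y)) UNIV"
    by (rule has_sum_diagonal_support[OF wp_bilateral[OF q an(3)], of "\<lambda>m. (m, m)"])
       (auto simp: inj_def image_iff power_int_mult_distrib split: if_splits)
  have "((\<lambda>(m, n). addition_coeff q m n * (x powi m * y powi n)) has_sum
       (- 1 / 4 + wp q x + wp q y + wp q (x * y))) UNIV"
    using has_sum_add[OF has_sum_add[OF has_sum_add[OF c bx] by0] bxy]
    unfolding addition_coeff_eq[OF q] by (simp only: case_prod_unfold distrib_right)
  with L show ?thesis by (rule has_sum_unique)
qed

definition drho :: "complex \<Rightarrow> complex \<Rightarrow> complex" where
  "drho q x = x / (1 - x) ^ 2 + (lambert 1 1 q x + lambert 1 1 q (inverse x))"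

definition dwp :: "complex \<Rightarrow> complex \<Rightarrow> complex" where
  "dwp q x = lambert 2 1 q x - lambert 2 1 q (inverse x)"

definition ddwp :: "complex \<Rightarrow> complex \<Rightarrow> complex" where
  "ddwp q x = lambert 2 2 q x + lambert 2 2 q (inverse x)"

text \<open>
  The common domain of the identities between \<open>rho\<close> and \<open>wp\<close>: \<open>rho q\<close> has a pole at \<open>1\<close>.
\<close>

definition punctured :: "complex \<Rightarrow> complex set" where
  "punctured q = annulus q - {1}"

lemma open_annulus: "open (annulus q)"
  unfolding annulus_def Collect_conj_eq by (intro open_Int open_Collect_less continuous_intros)

lemma open_punctured: "open (punctured q)"
  unfolding punctured_def by (intro open_Diff open_annulus) auto

lemma annulus_inverse: "x \<in> annulus q \<Longrightarrow> inverse x \<in> annulus q"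
  using annulusD[of x q] by (auto simp: annulus_def norm_mult norm_divide divide_simps)

lemma punctured_inverse: "x \<in> punctured q \<Longrightarrow> inverse x \<in> punctured q"
  using annulus_inverse[of x q] annulusD(1)[of x q]
  by (auto simp: punctured_def) 

lemma unimodular_annulus: "norm q < 1 \<Longrightarrow> norm x = 1 \<Longrightarrow> x \<in> annulus q"
  by (auto simp: annulus_def norm_mult)

lemma rho_inverse: "x \<noteq> 0 \<Longrightarrow> rho q (inverse x) = - rho q x"
  by (cases "x = 1") (auto simp: rho_def divide_simps, auto simp: algebra_simps)

lemma drho_inverse: "x \<noteq> 0 \<Longrightarrow> drho q (inverse x) = drho q x"
proof (cases "x = 1")
  case False
  assume x: "x \<noteq> 0"
  have "1 - inverse x = - (1 - x) * inverse x" using x by (simp add: field_simps)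
  then have "inverse x / (1 - inverse x) ^ 2 = x / (1 - x) ^ 2"
    using x False by (simp add: field_simps power2_eq_square)
  then show ?thesis by (simp add: drho_def add.commute)
qed auto

lemma wp_inverse: "wp q (inverse x) = wp q x"
  by (simp add: wp_def)

lemma dwp_inverse: "dwp q (inverse x) = - dwp q x"
  by (simp add: dwp_def)

lemma lambert_deriv_inverse:
  assumes "norm q < 1" "x \<in> annulus q"
  shows "((\<lambda>x. lambert j k q (inverse x)) has_field_derivative - lambert j (k + 1) q (inverse x) / x) (at x)"
proof -
  note x = annulusD[OF assms(2)]
  have "((\<lambda>x. lambert j k q (inverse x)) has_field_derivative
      lambert j (k + 1) q (inverse x) / inverse x * - (inverse x ^ Suc (Suc 0))) (at x)"
    by (rule DERIV_chain2[OF lambert_deriv_x[OF assms(1) x(3)] DERIV_inverse]) (use x in auto)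
  then show ?thesis using x by (simp add: field_simps)
qed

lemma rho_deriv:
  assumes "norm q < 1" "x \<in> punctured q"
  shows "(rho q has_field_derivative drho q x / x) (at x)"
proof -
  have an: "x \<in> annulus q" "1 - x \<noteq> 0" using assms by (auto simp: punctured_def)
  note x = annulusD[OF an(1)]
  have 1: "((\<lambda>x. (1 + x) / (2 * (1 - x))) has_field_derivative 1 / (1 - x) ^ 2) (at x)"
  proof -
    have "2 * (1 - x) \<noteq> 0" using an(2) by simp
    then have "((\<lambda>x. (1 + x) / (2 * (1 - x))) has_field_derivative
        ((0 + 1) * (2 * (1 - x)) - (1 + x) * (2 * (0 - 1))) / (2 * (1 - x) * (2 * (1 - x)))) (at x)"
      by (intro DERIV_divide DERIV_add DERIV_cmult DERIV_diff DERIV_const DERIV_ident)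
    moreover have "((0 + 1) * (2 * (1 - x)) - (1 + x) * (2 * (0 - 1))) / (2 * (1 - x) * (2 * (1 - x))) = 1 / (1 - x) ^ 2"
      using an(2) by (simp add: divide_simps power2_eq_square) (simp add: algebra_simps)
    ultimately show ?thesis by simp
  qed
  have "((\<lambda>x. (1 + x) / (2 * (1 - x)) + (lambert 1 0 q x - lambert 1 0 q (inverse x)))
     has_field_derivative 1 / (1 - x) ^ 2 + (lambert 1 (0 + 1) q x / x - (- lambert 1 (0 + 1) q (inverse x) / x))) (at x)"
    by (intro DERIV_add DERIV_diff 1 lambert_deriv_x lambert_deriv_inverse assms x an)
  moreover have "1 / (1 - x) ^ 2 + (lambert 1 (0 + 1) q x / x - (- lambert 1 (0 + 1) q (inverse x) / x))
      = drho q x / x"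
    using x by (simp add: drho_def add_divide_distrib)
  ultimately show ?thesis by (simp add: rho_def[abs_def])
qed

lemma wp_deriv:
  assumes "norm q < 1" "x \<in> annulus q"
  shows "(wp q has_field_derivative dwp q x / x) (at x)"
proof -
  note x = annulusD[OF assms(2)]
  have "(wp q has_field_derivative lambert 2 (0 + 1) q x / x + (- lambert 2 (0 + 1) q (inverse x) / x)) (at x)"
    unfolding wp_def[abs_def] by (intro DERIV_add lambert_deriv_x lambert_deriv_inverse assms x)
  then show ?thesis by (simp add: dwp_def diff_divide_distrib)
qed

lemma dwp_deriv:
  assumes "norm q < 1" "x \<in> annulus q"
  shows "(dwp q has_field_derivative ddwp q x / x) (at x)"
proof -
  note x = annulusD[OF assms(2)]
  have "(dwp q has_field_derivative lambert 2 (1 + 1) q x / x - (- lambert 2 (1 + 1) q (inverse x) / x)) (at x)"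
    unfolding dwp_def[abs_def] by (intro DERIV_diff lambert_deriv_x lambert_deriv_inverse assms x)
  then show ?thesis by (simp add: ddwp_def add_divide_distrib)
qed

text \<open>
  In terms of \<open>z = 1 / (x y)\<close> the addition theorem is symmetric in \<open>x\<close>, \<open>y\<close>, \<open>z\<close>, and it is invariant under
  inverting all three since \<open>rho\<close> is odd and \<open>wp\<close> is even. Two of the three points lie on the same side of
  the unit circle, so permutation and inversion reduce every case to the region already treated.
\<close>

lemma addition_off_circle:
  assumes q: "q \<noteq> 0" "norm q < 1"
    and an: "x \<in> annulus q" "y \<in> annulus q" "z \<in> annulus q" and xyz: "x * y * z = 1"
    and off: "norm x \<noteq> 1" "norm y \<noteq> 1" "norm z \<noteq> 1"
  shows "rho q x * rho q y + rho q y * rho q z + rho q z * rho q x = - 1 / 4 + wp q x + wp q y + wp q z"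
proof -
  have small: "rho q x * rho q y + rho q y * rho q z + rho q z * rho q x = - 1 / 4 + wp q x + wp q y + wp q z"
    if "norm x < 1" "norm y < 1" "z \<in> annulus q" "x * y * z = 1" for x y z
  proof -
    have nz: "x \<noteq> 0" "y \<noteq> 0" using that by auto
    then have z: "z = inverse (x * y)" using that by (simp add: field_simps)
    then have xy: "norm q < norm (x * y)"
      using that annulus_inverse[OF that(3)] by (auto simp: annulus_def)
    have "rho q z = - rho q (x * y)" "wp q z = wp q (x * y)"
      using nz unfolding z by (simp_all only: rho_inverse wp_inverse mult_eq_0_iff simp_thms)
    then show ?thesis using addition_inner[OF q that(1,2) xy] by (simp add: algebra_simps)
  qed
  have two: "rho q x * rho q y + rho q y * rho q z + rho q z * rho q x = - 1 / 4 + wp q x + wp q y + wp q z"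
    if "norm x < 1 \<longleftrightarrow> norm y < 1" "norm x \<noteq> 1" "norm y \<noteq> 1"
       "x \<in> annulus q" "y \<in> annulus q" "z \<in> annulus q" "x * y * z = 1" for x y z
  proof (cases "norm x < 1")
    case True
    then show ?thesis using small[of x y z] that by auto
  next
    case False
    then have "norm (inverse x) < 1" "norm (inverse y) < 1"
      using that annulusD(1)[of x q] annulusD(1)[of y q] by (auto simp: norm_divide divide_simps)
    moreover have "inverse x * inverse y * inverse z = 1"
      using that(7) by (metis inverse_1 inverse_mult_distrib)
    ultimately show ?thesis
      using small[of "inverse x" "inverse y" "inverse z"] that(4-6) annulus_inverse[of z q]
        rho_inverse[OF annulusD(1), of x q q] rho_inverse[OF annulusD(1), of y q q]
        rho_inverse[OF annulusD(1), of z q q]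
      by (simp add: wp_inverse)
  qed
  consider "norm x < 1 \<longleftrightarrow> norm y < 1" | "norm y < 1 \<longleftrightarrow> norm z < 1" | "norm z < 1 \<longleftrightarrow> norm x < 1"
    by blast
  then show ?thesis
  proof cases
    case 1
    then show ?thesis using two[of x y z] an off xyz by blast
  next
    case 2
    then show ?thesis using two[of y z x] an off xyz by (simp add: mult_ac add_ac)
  next
    case 3
    then show ?thesis using two[of z x y] an off xyz by (simp add: mult_ac add_ac)
  qed
qed

lemma eventually_norm_scaled_ne:
  fixes x :: complex
  assumes k: "0 < k"
  shows "\<forall>\<^sub>F r in at (1::real). norm (x * of_real r ^ k) \<noteq> 1"
proof (cases "norm x = 1")
  case True
  have "\<forall>\<^sub>F r in at (1::real). r > 0"
    by (rule order_tendstoD(1)[OF tendsto_ident_at]) simp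
  moreover have "\<forall>\<^sub>F r in at (1::real). r \<noteq> 1" by (rule eventually_neq_at_within)
  ultimately show ?thesis
  proof eventually_elim
    case (elim r)
    have n: "norm (x * of_real r ^ k) = r ^ k"
      unfolding norm_mult norm_power True norm_of_real using elim(1) by simp
    show ?case
    proof
      assume "norm (x * of_real r ^ k) = 1"
      then have "r ^ k = 1 ^ k" using n by simp
      then have "r = 1" using elim(1) k by (intro power_eq_imp_eq_base[of r k 1]) auto
      then show False using elim(2) by contradiction
    qed
  qed
next
  case False
  have "isCont (\<lambda>r. norm (x * of_real r ^ k)) (1::real)"
    by (intro continuous_intros)
  then have "((\<lambda>r. norm (x * of_real r ^ k)) \<longlongrightarrow> norm x) (at (1::real))"
    unfolding isCont_def by simp
  then show ?thesis using False by (rule tendsto_imp_eventually_ne)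
qed

lemma rho_tendsto:
  assumes "norm q < 1" "x \<in> punctured q" "(f \<longlongrightarrow> x) F"
  shows "((\<lambda>r. rho q (f r)) \<longlongrightarrow> rho q x) F"
  using isCont_tendsto_compose[OF DERIV_isCont[OF rho_deriv[OF assms(1,2)]] assms(3)] .

lemma wp_tendsto:
  assumes "norm q < 1" "x \<in> annulus q" "(f \<longlongrightarrow> x) F"
  shows "((\<lambda>r. wp q (f r)) \<longlongrightarrow> wp q x) F"
  using isCont_tendsto_compose[OF DERIV_isCont[OF wp_deriv[OF assms(1,2)]] assms(3)] .

text \<open>
  Points on the unit circle, which include the roots of unity, are reached by the radial deformation
  \<open>(x r, y r, z / r\<^sup>2)\<close> with \<open>r \<rightarrow> 1\<close>, which keeps the product of the three points equal to \<open>1\<close>.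
\<close>

lemma addition_symmetric:
  assumes q: "q \<noteq> 0" "norm q < 1"
    and an: "x \<in> punctured q" "y \<in> punctured q" "z \<in> punctured q" and xyz: "x * y * z = 1"
  shows "rho q x * rho q y + rho q y * rho q z + rho q z * rho q x = - 1 / 4 + wp q x + wp q y + wp q z"
proof -
  have an': "x \<in> annulus q" "y \<in> annulus q" "z \<in> annulus q" using an by (auto simp: punctured_def)
  define X Y Z where "X = (\<lambda>r::real. x * of_real r ^ 1)" and "Y = (\<lambda>r::real. y * of_real r ^ 1)"
    and "Z = (\<lambda>r::real. inverse (inverse z * of_real r ^ 2))"
  have z: "z \<noteq> 0" using xyz by auto
  have lim: "(X \<longlongrightarrow> x) (at 1)" "(Y \<longlongrightarrow> y) (at 1)" "(Z \<longlongrightarrow> z) (at 1)"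
    unfolding X_def Y_def Z_def by (rule tendsto_eq_intros refl | use z in simp)+
  have "\<forall>\<^sub>F r in at 1. X r \<in> annulus q" "\<forall>\<^sub>F r in at 1. Y r \<in> annulus q" "\<forall>\<^sub>F r in at 1. Z r \<in> annulus q"
    by (rule topological_tendstoD[OF _ open_annulus]; (rule lim an')+)+
  moreover have "\<forall>\<^sub>F r in at 1. norm (X r) \<noteq> 1" "\<forall>\<^sub>F r in at 1. norm (Y r) \<noteq> 1"
    unfolding X_def Y_def by (rule eventually_norm_scaled_ne; simp)+
  moreover have "\<forall>\<^sub>F r in at 1. norm (Z r) \<noteq> 1"
    unfolding Z_def norm_inverse inverse_eq_1_iff by (rule eventually_norm_scaled_ne) simp
  moreover have "\<forall>\<^sub>F r in at (1::real). r > 0"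
    by (rule order_tendstoD(1)[OF tendsto_ident_at]) simp
  ultimately have ev: "\<forall>\<^sub>F r in at 1. rho q (X r) * rho q (Y r) + rho q (Y r) * rho q (Z r) + rho q (Z r) * rho q (X r)
        = - 1 / 4 + wp q (X r) + wp q (Y r) + wp q (Z r)"
  proof eventually_elim
    case (elim r)
    have "X r * Y r * Z r = x * y * z"
      using elim z by (simp add: X_def Y_def Z_def field_simps power2_eq_square)
    then show ?case using elim addition_off_circle[OF q, of "X r" "Y r" "Z r"] xyz by simp
  qed
  have "((\<lambda>r. rho q (X r) * rho q (Y r) + rho q (Y r) * rho q (Z r) + rho q (Z r) * rho q (X r)) \<longlongrightarrow>
          rho q x * rho q y + rho q y * rho q z + rho q z * rho q x) (at 1)"
    by (intro tendsto_intros rho_tendsto lim q an)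
  moreover have "((\<lambda>r. - 1 / 4 + wp q (X r) + wp q (Y r) + wp q (Z r)) \<longlongrightarrow>
          - 1 / 4 + wp q x + wp q y + wp q z) (at 1)"
    by (intro tendsto_intros wp_tendsto lim q an')
  then have "((\<lambda>r. rho q (X r) * rho q (Y r) + rho q (Y r) * rho q (Z r) + rho q (Z r) * rho q (X r)) \<longlongrightarrow>
          - 1 / 4 + wp q x + wp q y + wp q z) (at 1)"
    by (rule Lim_transform_eventually) (use ev in \<open>simp add: eq_commute\<close>)
  ultimately show ?thesis using tendsto_unique[OF at_neq_bot] by blast
qed

lemma addition:
  assumes q: "q \<noteq> 0" "norm q < 1"
    and an: "x \<in> punctured q" "y \<in> punctured q" "x * y \<in> punctured q"
  shows "rho q x * rho q y - (rho q x + rho q y) * rho q (x * y)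
           = - 1 / 4 + wp q x + wp q y + wp q (x * y)"
proof -
  have nz: "x * y \<noteq> 0" using annulusD[of "x * y" q] an by (auto simp: punctured_def)
  then have "x * y * inverse (x * y) = 1" by (rule right_inverse)
  note sym = addition_symmetric[OF q an(1,2) punctured_inverse[OF an(3)] this]
  have "rho q x * rho q y + rho q y * - rho q (x * y) + - rho q (x * y) * rho q x
      = - 1 / 4 + wp q x + wp q y + wp q (x * y)"
    using sym unfolding rho_inverse[OF nz] wp_inverse .
  then show ?thesis by (simp add: algebra_simps)
qed

text \<open>
  The limit \<open>y \<rightarrow> 1/x\<close> of the addition theorem: with \<open>x y = w\<close> the pole of \<open>rho q w\<close> at \<open>w = 1\<close> meets the zero of
  \<open>rho q x + rho q (w / x)\<close>, and their product tends to minus the derivative of \<open>rho\<close>.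
\<close>

lemma ramanujan:
  assumes q: "q \<noteq> 0" "norm q < 1" and x: "x \<in> punctured q"
  shows "drho q x = rho q x ^ 2 - 1 / 4 + 2 * wp q x + wp q 1"
proof -
  have x0: "x \<noteq> 0" using x annulusD(1)[of x q] by (auto simp: punctured_def)
  have ix: "inverse x \<in> punctured q" using x by (rule punctured_inverse)
  have one: "1 \<in> annulus q" using q by (intro unimodular_annulus) auto
  define h where "h = (\<lambda>w. rho q (w * inverse x))"
  \<comment> \<open>\<open>g\<close> is the part of \<open>rho\<close> that is regular at \<open>1\<close>; it vanishes there.\<close>
  define g where "g = (\<lambda>w. lambert 1 0 q w - lambert 1 0 q (inverse w))"
  have h1: "h 1 = - rho q x" using x0 by (simp add: h_def rho_inverse)
  have yl: "((\<lambda>w. w * inverse x) \<longlongrightarrow> inverse x) (at 1)"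
    by (rule tendsto_eq_intros refl)+ simp
  have hd: "(h has_field_derivative drho q x) (at 1)"
  proof -
    have "((\<lambda>w. rho q (w * inverse x)) has_field_derivative
        (drho q (1 * inverse x) / (1 * inverse x)) * inverse x) (at 1)"
      by (rule DERIV_chain2[where f = "rho q"])
         (use rho_deriv[OF q(2) ix] in \<open>auto intro!: derivative_eq_intros\<close>)
    then show ?thesis using x0 by (simp add: h_def drho_inverse)
  qed
  then have quot: "((\<lambda>w. (h w - h 1) / (w - 1)) \<longlongrightarrow> drho q x) (at 1)"
    by (simp add: has_field_derivative_iff)
  have hl: "(h \<longlongrightarrow> h 1) (at 1)" using DERIV_isCont[OF hd] by (simp add: isCont_def)
  have gl: "(g \<longlongrightarrow> 0) (at 1)"
  proof -
    have "isCont g 1" unfolding g_def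
      using DERIV_isCont[OF lambert_deriv_x[OF q(2) annulusD(2)[OF one] annulusD(1)[OF one], of 1 0]]
        DERIV_isCont[OF lambert_deriv_inverse[OF q(2) one, of 1 0]]
      by (intro continuous_intros)
    then show ?thesis by (simp add: isCont_def g_def)
  qed
  have "((\<lambda>w. rho q x * h w + (h w - h 1) / (w - 1) * ((1 + w) / 2) - (h w - h 1) * g w)
      \<longlongrightarrow> rho q x * h 1 + drho q x * ((1 + 1) / 2) - (h 1 - h 1) * 0) (at 1)"
    by (intro tendsto_intros hl gl quot) auto
  moreover have "((\<lambda>w. - 1 / 4 + wp q x + wp q (w * inverse x) + wp q w) \<longlongrightarrow>
      - 1 / 4 + wp q x + wp q (inverse x) + wp q 1) (at 1)"
    by (intro tendsto_intros wp_tendsto q yl one) (use ix in \<open>auto simp: punctured_def\<close>)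
  then have "((\<lambda>w. rho q x * h w + (h w - h 1) / (w - 1) * ((1 + w) / 2) - (h w - h 1) * g w)
      \<longlongrightarrow> - 1 / 4 + wp q x + wp q (inverse x) + wp q 1) (at 1)"
  proof (rule Lim_transform_eventually)
    have "\<forall>\<^sub>F w in at 1. w * inverse x \<in> punctured q"
      by (rule topological_tendstoD[OF yl open_punctured ix])
    moreover have "\<forall>\<^sub>F w in at 1. w \<in> annulus q"
      by (rule topological_tendstoD[OF tendsto_ident_at open_annulus one])
    moreover have "\<forall>\<^sub>F w in at (1::complex). w \<noteq> 1" by (rule eventually_neq_at_within)
    ultimately show "\<forall>\<^sub>F w in at 1. - 1 / 4 + wp q x + wp q (w * inverse x) + wp q w
       = rho q x * h w + (h w - h 1) / (w - 1) * ((1 + w) / 2) - (h w - h 1) * g w"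
    proof eventually_elim
      case (elim w)
      have w: "x * (w * inverse x) = w" using x0 by simp
      have eq: "rho q x * h w - (rho q x + h w) * rho q w = - 1 / 4 + wp q x + wp q (w * inverse x) + wp q w"
        using addition[OF q x elim(1)] elim unfolding w by (simp add: h_def punctured_def)
      define A where "A = (1 + w) / 2 / (w - 1)"
      have "(1 + w) / (2 * (1 - w)) = - A"
        using elim(3) by (simp add: A_def divide_simps) (simp add: algebra_simps)
      then have r: "rho q w = g w - A" by (simp add: rho_def g_def)
      have s: "(h w - h 1) / (w - 1) * ((1 + w) / 2) = (h w - h 1) * A" by (simp add: A_def)
      show ?case using eq unfolding r s unfolding h1 by (simp add: algebra_simps)
    qed
  qed
  ultimately have "rho q x * h 1 + drho q x * ((1 + 1) / 2) - (h 1 - h 1) * 0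
      = - 1 / 4 + wp q x + wp q (inverse x) + wp q 1"
    using tendsto_unique[OF at_neq_bot] by blast
  then show ?thesis by (simp add: h1 wp_inverse power2_eq_square algebra_simps)
qed

lemma drho_deriv:
  assumes q: "q \<noteq> 0" "norm q < 1" and x: "x \<in> punctured q"
  shows "(drho q has_field_derivative 2 * (rho q x * drho q x + dwp q x) / x) (at x)"
proof -
  have an: "x \<in> annulus q" using x by (auto simp: punctured_def)
  have "((\<lambda>x. rho q x ^ 2 - 1 / 4 + 2 * wp q x + wp q 1) has_field_derivative
       2 * (rho q x * drho q x + dwp q x) / x) (at x)"
    by (rule derivative_eq_intros refl rho_deriv wp_deriv q x an)+ (simp add: add_divide_distrib algebra_simps)
  then show ?thesis
    by (rule has_field_derivative_transform_within_open[OF _ open_punctured x])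
       (use ramanujan[OF q] in simp)
qed

lemma derivatives_agree:
  assumes "(f has_field_derivative a) (at x)" "(g has_field_derivative b) (at x)"
    "open S" "x \<in> S" "\<And>y. y \<in> S \<Longrightarrow> f y = g (y::complex)"
  shows "a = b"
  using DERIV_unique[OF has_field_derivative_transform_within_open[OF assms(1,3,4,5)] assms(2)] .

text \<open>
  The addition theorem differentiated by \<open>x d/dx\<close>.
\<close>

lemma addition_deriv1:
  assumes q: "q \<noteq> 0" "norm q < 1"
    and an: "x \<in> punctured q" "y \<in> punctured q" "x * y \<in> punctured q"
  shows "drho q x * (rho q y - rho q (x * y)) - (rho q x + rho q y) * drho q (x * y)
           = dwp q x + dwp q (x * y)"
proof -
  have an': "x \<in> annulus q" "y \<in> annulus q" "x * y \<in> annulus q" using an by (auto simp: punctured_def)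
  have nz: "x \<noteq> 0" "y \<noteq> 0" using annulusD(1)[OF an'(1)] annulusD(1)[OF an'(2)] .
  define S where "S = punctured q \<inter> (\<lambda>x. x * y) -` punctured q"
  have S: "open S" "x \<in> S"
    unfolding S_def by (intro open_Int open_punctured open_vimage continuous_intros) (simp add: an)
  have m: "((\<lambda>x. x * y) has_field_derivative y) (at x)" by (auto intro!: derivative_eq_intros)
  note rx = rho_deriv[OF q(2) an(1)] and rxy = DERIV_chain2[OF rho_deriv[OF q(2) an(3)] m]
  note wx = wp_deriv[OF q(2) an'(1)] and wxy = DERIV_chain2[OF wp_deriv[OF q(2) an'(3)] m]
  have "drho q x / x * (rho q y - rho q (x * y)) - (rho q x + rho q y) * (drho q (x * y) / (x * y) * y)
      = dwp q x / x + dwp q (x * y) / (x * y) * y"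
  proof (rule derivatives_agree[OF _ _ S])
    show "((\<lambda>x. rho q x * rho q y - (rho q x + rho q y) * rho q (x * y)) has_field_derivative
       drho q x / x * (rho q y - rho q (x * y)) - (rho q x + rho q y) * (drho q (x * y) / (x * y) * y)) (at x)"
      by (rule derivative_eq_intros rx rxy refl)+ (simp add: algebra_simps)
    show "((\<lambda>x. - 1 / 4 + wp q x + wp q y + wp q (x * y)) has_field_derivative
       dwp q x / x + dwp q (x * y) / (x * y) * y) (at x)"
      by (rule derivative_eq_intros wx wxy refl)+ simp
  qed (use addition[OF q _ an(2)] in \<open>auto simp: S_def\<close>)
  then show ?thesis using nz by (simp add: divide_simps)
qed

text \<open>
  The preceding identity differentiated by \<open>y d/dy\<close>. It determines the second derivative of \<open>wp\<close>, and
  thereby the \<open>q\<close>-derivative of \<open>drho\<close>, through values of lower order.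
\<close>

lemma addition_deriv2:
  assumes q: "q \<noteq> 0" "norm q < 1"
    and an: "x \<in> punctured q" "y \<in> punctured q" "x * y \<in> punctured q"
  shows "drho q x * drho q y - (drho q x + drho q y) * drho q (x * y)
          - (rho q x + rho q y) * (2 * (rho q (x * y) * drho q (x * y) + dwp q (x * y)))
           = ddwp q (x * y)"
proof -
  have an': "x \<in> annulus q" "y \<in> annulus q" "x * y \<in> annulus q" using an by (auto simp: punctured_def)
  have nz: "x \<noteq> 0" "y \<noteq> 0" using annulusD(1)[OF an'(1)] annulusD(1)[OF an'(2)] .
  define S where "S = punctured q \<inter> (\<lambda>y. x * y) -` punctured q"
  have S: "open S" "y \<in> S"
    unfolding S_def by (intro open_Int open_punctured open_vimage continuous_intros) (simp add: an)
  have m: "((\<lambda>y. x * y) has_field_derivative x) (at y)" by (auto intro!: derivative_eq_intros)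
  note ry = rho_deriv[OF q(2) an(2)] and rxy = DERIV_chain2[OF rho_deriv[OF q(2) an(3)] m]
  note Rxy = DERIV_chain2[OF drho_deriv[OF q an(3)] m] and wxy = DERIV_chain2[OF dwp_deriv[OF q(2) an'(3)] m]
  let ?T = "2 * (rho q (x * y) * drho q (x * y) + dwp q (x * y)) / (x * y) * x"
  have "drho q x * (drho q y / y - drho q (x * y) / (x * y) * x)
       - (drho q y / y * drho q (x * y) + (rho q x + rho q y) * ?T)
      = ddwp q (x * y) / (x * y) * x"
  proof (rule derivatives_agree[OF _ _ S])
    show "((\<lambda>y. drho q x * (rho q y - rho q (x * y)) - (rho q x + rho q y) * drho q (x * y)) has_field_derivative
       drho q x * (drho q y / y - drho q (x * y) / (x * y) * x)
       - (drho q y / y * drho q (x * y) + (rho q x + rho q y) * ?T)) (at y)"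
      by (rule derivative_eq_intros ry rxy Rxy refl)+
         (simp add: algebra_simps)
    show "((\<lambda>y. dwp q x + dwp q (x * y)) has_field_derivative ddwp q (x * y) / (x * y) * x) (at y)"
      by (rule derivative_eq_intros wxy refl)+ simp
  qed (use addition_deriv1[OF q an(1)] in \<open>auto simp: S_def\<close>)
  moreover have "A / (x * y) * x = A / y" for A using nz by simp
  ultimately have "drho q x * (drho q y / y - drho q (x * y) / y) - (drho q y / y * drho q (x * y)
      + (rho q x + rho q y) * (2 * (rho q (x * y) * drho q (x * y) + dwp q (x * y)) / y)) = ddwp q (x * y) / y"
    by simp
  moreover have "A * (B - C) - (B * C + D * E) = F"
    if "A * (B / y - C / y) - (B / y * C + D * (E / y)) = F / y" for A B C D E F
  proof -
    have "(A * (B - C) - (B * C + D * E)) / y = A * (B / y - C / y) - (B / y * C + D * (E / y))"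
      using nz by (simp add: diff_divide_distrib add_divide_distrib right_diff_distrib)
    then show ?thesis using that nz by simp
  qed
  ultimately have "drho q x * (drho q y - drho q (x * y)) - (drho q y * drho q (x * y)
      + (rho q x + rho q y) * (2 * (rho q (x * y) * drho q (x * y) + dwp q (x * y)))) = ddwp q (x * y)"
    by blast
  then show ?thesis by (simp add: algebra_simps)
qed

section \<open>The differential system at the fifth roots of unity\<close>

text \<open>
  The value of the Euler operator \<open>q d/dq\<close>. Differentiability is part of the notion, so that at \<open>q = 0\<close>, where
  the value is always \<open>0\<close>, it still says that \<open>f\<close> is differentiable there.
\<close>

definition has_euler_deriv :: "(complex \<Rightarrow> complex) \<Rightarrow> complex \<Rightarrow> complex \<Rightarrow> bool" where
  "has_euler_deriv f v q \<longleftrightarrow> (\<exists>d. (f has_field_derivative d) (at q) \<and> q * d = v)"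

lemma euler_deriv_const: "has_euler_deriv (\<lambda>q. c) 0 q"
  unfolding has_euler_deriv_def by (rule exI[of _ 0]) auto

lemma euler_deriv_add:
  "has_euler_deriv f u q \<Longrightarrow> has_euler_deriv g v q \<Longrightarrow> has_euler_deriv (\<lambda>q. f q + g q) (u + v) q"
  unfolding has_euler_deriv_def by (metis DERIV_add distrib_left)

lemma euler_deriv_diff:
  "has_euler_deriv f u q \<Longrightarrow> has_euler_deriv g v q \<Longrightarrow> has_euler_deriv (\<lambda>q. f q - g q) (u - v) q"
  unfolding has_euler_deriv_def by (metis DERIV_diff right_diff_distrib)

lemma euler_deriv_mult:
  assumes "has_euler_deriv f u q" "has_euler_deriv g v q"
  shows "has_euler_deriv (\<lambda>q. f q * g q) (u * g q + f q * v) q"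
proof -
  obtain d e where d: "(f has_field_derivative d) (at q)" "q * d = u"
    and e: "(g has_field_derivative e) (at q)" "q * e = v"
    using assms unfolding has_euler_deriv_def by blast
  have "((\<lambda>q. f q * g q) has_field_derivative d * g q + e * f q) (at q)"
    by (rule DERIV_mult d e)+
  moreover have "q * (d * g q + e * f q) = u * g q + f q * v"
    unfolding d(2)[symmetric] e(2)[symmetric] by (simp add: algebra_simps)
  ultimately show ?thesis unfolding has_euler_deriv_def by blast
qed

lemma euler_deriv_divide:
  assumes "has_euler_deriv f u q" "has_euler_deriv g v q" "g q \<noteq> 0"
  shows "has_euler_deriv (\<lambda>q. f q / g q) ((u * g q - f q * v) / (g q * g q)) q"
proof -
  obtain d e where d: "(f has_field_derivative d) (at q)" "q * d = u"
    and e: "(g has_field_derivative e) (at q)" "q * e = v"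
    using assms unfolding has_euler_deriv_def by blast
  have "((\<lambda>q. f q / g q) has_field_derivative (d * g q - f q * e) / (g q * g q)) (at q)"
    by (rule DERIV_divide d e assms)+
  moreover have "q * ((d * g q - f q * e) / (g q * g q)) = (u * g q - f q * v) / (g q * g q)"
    unfolding d(2)[symmetric] e(2)[symmetric] by (simp add: algebra_simps)
  ultimately show ?thesis unfolding has_euler_deriv_def by blast
qed

lemma euler_deriv_cmult:
  "has_euler_deriv f u q \<Longrightarrow> has_euler_deriv (\<lambda>q. c * f q) (c * u) q"
  using euler_deriv_mult[OF euler_deriv_const, of f u q c] by simp

lemma euler_deriv_exp:
  assumes "has_euler_deriv f u q"
  shows "has_euler_deriv (\<lambda>q. exp (f q)) (exp (f q) * u) q"
proof -
  obtain d where d: "(f has_field_derivative d) (at q)" "q * d = u"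
    using assms unfolding has_euler_deriv_def by blast
  have "((\<lambda>q. exp (f q)) has_field_derivative exp (f q) * d) (at q)"
    by (rule DERIV_fun_exp d)+
  then show ?thesis unfolding has_euler_deriv_def d(2)[symmetric] by (auto intro!: exI)
qed

lemma euler_deriv_transform:
  assumes "has_euler_deriv f u q" "open S" "q \<in> S" "\<And>p. p \<in> S \<Longrightarrow> f p = g p"
  shows "has_euler_deriv g u q"
  using assms has_field_derivative_transform_within_open unfolding has_euler_deriv_def by blast

text \<open>
  Minus the logarithm of the theta product \<open>\<Prod>(1 - x q^n) (1 - q^n / x)\<close>.
\<close>

definition qlog :: "complex \<Rightarrow> complex \<Rightarrow> complex" where
  "qlog q x = lambert 1 (-1) q x + lambert 1 (-1) q (inverse x)"

lemma qlog_deriv_q: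
  assumes "norm q < 1" "x \<in> annulus q"
  shows "\<exists>d. ((\<lambda>q. qlog q x) has_field_derivative d) (at q) \<and> q * d = wp q x \<and> (q = 0 \<longrightarrow> d = x + inverse x)"
proof -
  note x = annulusD[OF assms(2)]
  obtain d where d: "((\<lambda>q. lambert 1 (-1) q x) has_field_derivative d) (at q)"
    "q * d = lambert 2 (- 1 + 1) q x" "q = 0 \<longrightarrow> d = x" using lambert_deriv_q[OF assms(1) x(2)] by blast
  obtain d' where d': "((\<lambda>q. lambert 1 (-1) q (inverse x)) has_field_derivative d') (at q)"
    "q * d' = lambert 2 (- 1 + 1) q (inverse x)" "q = 0 \<longrightarrow> d' = inverse x"
    using lambert_deriv_q[OF assms(1) x(3)] by blast
  show ?thesis
    by (rule exI[of _ "d + d'"])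
       (use DERIV_add[OF d(1) d'(1)] d d' in \<open>auto simp: qlog_def[abs_def] wp_def distrib_left\<close>)
qed

lemma qlog_euler:
  assumes "norm q < 1" "x \<in> annulus q"
  shows "has_euler_deriv (\<lambda>q. qlog q x) (wp q x) q"
  using qlog_deriv_q[OF assms] unfolding has_euler_deriv_def by blast

lemma lambert_euler:
  assumes "norm q < 1" "norm (q * x) < 1"
  shows "has_euler_deriv (\<lambda>q. lambert 1 k q x) (lambert 2 (k + 1) q x) q"
  using lambert_deriv_q[OF assms] unfolding has_euler_deriv_def by blast

text \<open>
  The heat equation of the theta function: the \<open>q\<close>-derivative of \<open>rho\<close> is the \<open>x\<close>-derivative of \<open>wp\<close>.
\<close>

lemma rho_euler:
  assumes "norm q < 1" "x \<in> annulus q"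
  shows "has_euler_deriv (\<lambda>q. rho q x) (dwp q x) q"
proof -
  note x = annulusD[OF assms(2)]
  have "has_euler_deriv (\<lambda>q. rho q x) (0 + (lambert 2 (0 + 1) q x - lambert 2 (0 + 1) q (inverse x))) q"
    unfolding rho_def by (intro euler_deriv_add euler_deriv_diff euler_deriv_const lambert_euler assms x)
  then show ?thesis by (simp add: dwp_def)
qed

lemma drho_euler:
  assumes "norm q < 1" "x \<in> annulus q"
  shows "has_euler_deriv (\<lambda>q. drho q x) (ddwp q x) q"
proof -
  note x = annulusD[OF assms(2)]
  have "has_euler_deriv (\<lambda>q. drho q x) (0 + (lambert 2 (1 + 1) q x + lambert 2 (1 + 1) q (inverse x))) q"
    unfolding drho_def by (intro euler_deriv_add euler_deriv_const lambert_euler assms x)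
  then show ?thesis by (simp add: ddwp_def)
qed

definition zeta5 :: complex where "zeta5 = cis (2 * pi / 5)"

lemma zeta5_power: "zeta5 ^ 5 = 1"
  unfolding zeta5_def Complex.DeMoivre by simp

lemma norm_zeta5: "norm zeta5 = 1"
  by (simp add: zeta5_def)

lemma zeta5_nonzero: "zeta5 \<noteq> 0"
  using norm_zeta5 by auto

lemma zeta5_inverse: "inverse zeta5 = zeta5 ^ 4" "inverse (zeta5 ^ 2) = zeta5 ^ 3"
  using zeta5_power zeta5_nonzero by (auto simp: field_simps power_numeral_reduce)

lemma zeta5_neq_1: "zeta5 \<noteq> 1"
proof
  assume "zeta5 = 1"
  then have "cos (2 * pi / 5) = 1" by (simp add: zeta5_def complex_eq_iff)
  moreover have "cos (2 * pi / 5) < cos 0" by (rule cos_monotone_0_pi) auto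
  ultimately show False by simp
qed

lemma zeta5_powers_neq_1: "zeta5 ^ 2 \<noteq> 1" "zeta5 ^ 3 \<noteq> 1" "zeta5 ^ 4 \<noteq> 1"
proof -
  show "zeta5 ^ 2 \<noteq> 1"
  proof
    assume *: "zeta5 ^ 2 = 1"
    have "zeta5 ^ 5 = (zeta5 ^ 2) ^ 2 * zeta5" by (simp add: power_numeral_reduce)
    then show False using * zeta5_power zeta5_neq_1 by simp
  qed
  then show "zeta5 ^ 3 \<noteq> 1" using zeta5_inverse(2) by (metis inverse_eq_1_iff)
  show "zeta5 ^ 4 \<noteq> 1" using zeta5_inverse(1) zeta5_neq_1 by (metis inverse_eq_1_iff)
qed

text \<open>
  The trace is a root of \<open>c\<^sup>2 + c - 1\<close>, and it is the positive one because \<open>2 \<pi> / 5 < \<pi> / 2\<close>.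
\<close>

lemma zeta5_trace: "zeta5 + inverse zeta5 = of_real ((sqrt 5 - 1) / 2)"
proof -
  define c where "c = 2 * cos (2 * pi / 5)"
  have zc: "zeta5 + inverse zeta5 = of_real c"
    unfolding zeta5_def cis_inverse c_def by (rule complex_eqI) simp_all
  have "(zeta5 - 1) * (1 + zeta5 + zeta5 ^ 2 + zeta5 ^ 3 + zeta5 ^ 4) = 0"
  proof -
    have "(zeta5 - 1) * (1 + zeta5 + zeta5 ^ 2 + zeta5 ^ 3 + zeta5 ^ 4) = zeta5 ^ 5 - 1" by algebra
    then show ?thesis unfolding zeta5_power by simp
  qed
  then have s: "1 + zeta5 + zeta5 ^ 2 + zeta5 ^ 3 + zeta5 ^ 4 = 0" using zeta5_neq_1 by simp
  have "(zeta5 + inverse zeta5) ^ 2 + (zeta5 + inverse zeta5) - 1 = 0"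
  proof -
    have "(zeta5 + zeta5 ^ 4) ^ 2 = zeta5 ^ 2 + 2 * zeta5 ^ 5 + zeta5 ^ 5 * zeta5 ^ 3" by algebra
    then have "(zeta5 + zeta5 ^ 4) ^ 2 + (zeta5 + zeta5 ^ 4) - 1 = 1 + zeta5 + zeta5 ^ 2 + zeta5 ^ 3 + zeta5 ^ 4"
      unfolding zeta5_power by simp
    then show ?thesis unfolding zeta5_inverse s .
  qed
  then have "complex_of_real (c ^ 2 + c - 1) = 0" unfolding zc of_real_diff of_real_add of_real_power of_real_1 .
  then have q: "c ^ 2 + c - 1 = 0" unfolding of_real_eq_0_iff .
  have pos: "c > 0" unfolding c_def using cos_gt_zero[of "2 * pi / 5"] by simp
  have "(c + 1 / 2) ^ 2 = c ^ 2 + c + 1 / 4" by (simp add: power2_eq_square algebra_simps)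
  then have "(c + 1 / 2) ^ 2 = (sqrt 5 / 2) ^ 2" using q by (simp add: power_divide)
  then have "c + 1 / 2 = sqrt 5 / 2" by (rule power2_eq_imp_eq) (use pos in auto)
  then have "c = (sqrt 5 - 1) / 2" by (simp add: field_simps)
  then show ?thesis unfolding zc by (rule arg_cong)
qed

lemma zeta5_square_trace: "zeta5 ^ 2 + inverse (zeta5 ^ 2) = - of_real ((sqrt 5 + 1) / 2)"
proof -
  have "zeta5 ^ 2 + inverse (zeta5 ^ 2) = (zeta5 + inverse zeta5) ^ 2 - 2"
    using zeta5_nonzero by (simp add: power2_sum power_inverse mult.assoc)
  also have "\<dots> = of_real (((sqrt 5 - 1) / 2) ^ 2 - 2)" unfolding zeta5_trace by simp
  also have "((sqrt 5 - 1) / 2) ^ 2 - 2 = - ((sqrt 5 + 1) / 2)"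
    by (simp add: power_divide power2_diff field_simps)
  finally show ?thesis by simp
qed

lemma zeta5_annulus: "norm q < 1 \<Longrightarrow> zeta5 ^ k \<in> annulus q"
  by (rule unimodular_annulus) (simp_all add: norm_power norm_zeta5)

lemma zeta5_punctured:
  assumes "norm q < 1"
  shows "zeta5 \<in> punctured q" "zeta5 ^ 2 \<in> punctured q" "zeta5 ^ 3 \<in> punctured q" "zeta5 ^ 4 \<in> punctured q"
  using zeta5_annulus[OF assms, of 1] zeta5_annulus[OF assms] zeta5_neq_1 zeta5_powers_neq_1
  by (auto simp: punctured_def)

text \<open>
  \<open>A1\<close> and \<open>A2\<close> behave like Eisenstein series of weight one and level five; \<open>E2\<close>, which is
  \<open>2 \<Sum>n q^n / (1 - q^n)\<close>, is the quasimodular Eisenstein series of weight two up to normalisation.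
\<close>

definition A1 :: "complex \<Rightarrow> complex" where "A1 q = rho q zeta5"
definition A2 :: "complex \<Rightarrow> complex" where "A2 q = rho q (zeta5 ^ 2)"
definition E2 :: "complex \<Rightarrow> complex" where "E2 q = wp q 1"

context
  fixes q :: complex
  assumes q0: "q \<noteq> 0" and q1: "norm q < 1"
begin

lemma reflection_zeta5:
  "rho q (zeta5 ^ 3) = - A2 q" "rho q (zeta5 ^ 4) = - A1 q"
  "wp q (zeta5 ^ 3) = wp q (zeta5 ^ 2)" "wp q (zeta5 ^ 4) = wp q zeta5"
  "drho q (zeta5 ^ 3) = drho q (zeta5 ^ 2)" "drho q (zeta5 ^ 4) = drho q zeta5"
  "dwp q (zeta5 ^ 3) = - dwp q (zeta5 ^ 2)" "dwp q (zeta5 ^ 4) = - dwp q zeta5"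
  using zeta5_nonzero
  by (simp_all add: A1_def A2_def rho_inverse drho_inverse wp_inverse dwp_inverse
      flip: zeta5_inverse)

text \<open>
  The addition theorem at \<open>(\<zeta>, \<zeta>)\<close> and at \<open>(\<zeta>\<^sup>2, \<zeta>\<^sup>2)\<close>, where \<open>rho\<close> at \<open>\<zeta>\<^sup>4\<close> is \<open>- A1\<close>, is a linear system for the two
  values of \<open>wp\<close>.
\<close>

lemma wp_zeta5:
  "wp q zeta5 = (1 / 4 + 2 * A1 q ^ 2 - 6 * A1 q * A2 q - A2 q ^ 2) / 3"
  "wp q (zeta5 ^ 2) = (1 / 4 + 2 * A2 q ^ 2 + 6 * A1 q * A2 q - A1 q ^ 2) / 3"
proof -
  note p = zeta5_punctured[OF q1]
  have m: "zeta5 * zeta5 = zeta5 ^ 2" "zeta5 ^ 2 * zeta5 ^ 2 = zeta5 ^ 4"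
    by (simp_all add: power_numeral_reduce)
  have 1: "A1 q ^ 2 - 2 * A1 q * A2 q = - 1 / 4 + 2 * wp q zeta5 + wp q (zeta5 ^ 2)"
    using addition[OF q0 q1 p(1) p(1)] p(2) unfolding m
    by (simp add: A1_def A2_def power2_eq_square algebra_simps)
  have 2: "A2 q ^ 2 + 2 * A1 q * A2 q = - 1 / 4 + 2 * wp q (zeta5 ^ 2) + wp q zeta5"
    using addition[OF q0 q1 p(2) p(2)] p(4) unfolding m reflection_zeta5 A2_def[symmetric]
    by (simp add: power2_eq_square algebra_simps)
  define u v a b where "u = wp q zeta5" and "v = wp q (zeta5 ^ 2)" and "a = A1 q" and "b = A2 q"
  show "wp q zeta5 = (1 / 4 + 2 * A1 q ^ 2 - 6 * A1 q * A2 q - A2 q ^ 2) / 3"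
    using 1 2 unfolding u_def[symmetric] v_def[symmetric] a_def[symmetric] b_def[symmetric]
    by (simp add: divide_simps) algebra
  show "wp q (zeta5 ^ 2) = (1 / 4 + 2 * A2 q ^ 2 + 6 * A1 q * A2 q - A1 q ^ 2) / 3"
    using 1 2 unfolding u_def[symmetric] v_def[symmetric] a_def[symmetric] b_def[symmetric]
    by (simp add: divide_simps) algebra
qed

lemma drho_zeta5:
  "drho q zeta5 = A1 q ^ 2 - 1 / 4 + 2 * wp q zeta5 + E2 q"
  "drho q (zeta5 ^ 2) = A2 q ^ 2 - 1 / 4 + 2 * wp q (zeta5 ^ 2) + E2 q"
  using ramanujan[OF q0 q1 zeta5_punctured(1)[OF q1]] ramanujan[OF q0 q1 zeta5_punctured(2)[OF q1]]
  by (simp_all add: A1_def A2_def E2_def)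

text \<open>
  The differentiated addition theorem at the same two pairs of points is again a linear system of rank two.
\<close>

lemma dwp_zeta5:
  "dwp q zeta5 = A1 q / 12 - A1 q * E2 q + 13 / 6 * A1 q ^ 3 - 13 / 2 * A1 q ^ 2 * A2 q
      - 47 / 6 * A1 q * A2 q ^ 2 - 3 / 2 * A2 q ^ 3"
  "dwp q (zeta5 ^ 2) = A2 q / 12 - A2 q * E2 q + 3 / 2 * A1 q ^ 3 - 47 / 6 * A1 q ^ 2 * A2 q
      + 13 / 2 * A1 q * A2 q ^ 2 + 13 / 6 * A2 q ^ 3"
proof -
  note p = zeta5_punctured[OF q1]
  have m: "zeta5 * zeta5 = zeta5 ^ 2" "zeta5 ^ 2 * zeta5 ^ 2 = zeta5 ^ 4"
    by (simp_all add: power_numeral_reduce)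
  define R S where "R = drho q zeta5" and "S = drho q (zeta5 ^ 2)"
  define u v where "u = dwp q zeta5" and "v = dwp q (zeta5 ^ 2)"
  have 1: "R * (A1 q - A2 q) - 2 * A1 q * S = u + v"
    using addition_deriv1[OF q0 q1 p(1) p(1)] p(2) unfolding m
    by (simp add: A1_def A2_def R_def S_def u_def v_def algebra_simps)
  have 2: "S * (A1 q + A2 q) - 2 * A2 q * R = v - u"
    using addition_deriv1[OF q0 q1 p(2) p(2)] p(4) unfolding m reflection_zeta5 A2_def[symmetric]
    by (simp add: R_def S_def u_def v_def algebra_simps)
  have 3: "R = A1 q ^ 2 - 1 / 4 + 2 * ((1 / 4 + 2 * A1 q ^ 2 - 6 * A1 q * A2 q - A2 q ^ 2) / 3) + E2 q"
    "S = A2 q ^ 2 - 1 / 4 + 2 * ((1 / 4 + 2 * A2 q ^ 2 + 6 * A1 q * A2 q - A1 q ^ 2) / 3) + E2 q"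
    unfolding R_def S_def drho_zeta5 wp_zeta5 by simp_all
  define a b e where "a = A1 q" and "b = A2 q" and "e = E2 q"
  show "dwp q zeta5 = A1 q / 12 - A1 q * E2 q + 13 / 6 * A1 q ^ 3 - 13 / 2 * A1 q ^ 2 * A2 q
      - 47 / 6 * A1 q * A2 q ^ 2 - 3 / 2 * A2 q ^ 3"
    using 1 2 unfolding 3 u_def[symmetric] v_def[symmetric] a_def[symmetric] b_def[symmetric] e_def[symmetric]
    by (simp add: divide_simps) algebra
  show "dwp q (zeta5 ^ 2) = A2 q / 12 - A2 q * E2 q + 3 / 2 * A1 q ^ 3 - 47 / 6 * A1 q ^ 2 * A2 q
      + 13 / 2 * A1 q * A2 q ^ 2 + 13 / 6 * A2 q ^ 3"
    using 1 2 unfolding 3 u_def[symmetric] v_def[symmetric] a_def[symmetric] b_def[symmetric] e_def[symmetric]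
    by (simp add: divide_simps) algebra
qed

text \<open>
  The twice differentiated addition theorem at \<open>(\<zeta>, \<zeta>\<^sup>3)\<close>, whose product \<open>\<zeta>\<^sup>4\<close> is the inverse of \<open>\<zeta>\<close>.
\<close>

lemma ddwp_zeta5:
  "ddwp q zeta5 = 2 * (A1 q - A2 q) * (A1 q * drho q zeta5 + dwp q zeta5) - drho q zeta5 ^ 2"
proof -
  note p = zeta5_punctured[OF q1]
  have m: "zeta5 * zeta5 ^ 3 = zeta5 ^ 4" by (simp add: power_numeral_reduce)
  have "ddwp q (zeta5 ^ 4) = ddwp q zeta5"
    unfolding zeta5_inverse(1)[symmetric] by (simp add: ddwp_def)
  then show ?thesis
    using addition_deriv2[OF q0 q1 p(1) p(3)] p(4) unfolding m reflection_zeta5 A1_def[symmetric]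
    by (simp add: power2_eq_square algebra_simps)
qed

end

text \<open>
  Ramanujan's formula at \<open>\<zeta>\<close> expresses \<open>E2\<close> through \<open>drho\<close>, \<open>A1\<close> and \<open>A2\<close>, all of whose \<open>q\<close>-derivatives are known.
\<close>

lemma E2_euler:
  assumes "q \<noteq> 0" "norm q < 1"
  shows "has_euler_deriv E2 (- 1 / 144 + E2 q / 6 - E2 q ^ 2 - 5 / 9 * A1 q ^ 4 - 5 / 3 * A1 q ^ 3 * A2 q
      + 155 / 9 * A1 q ^ 2 * A2 q ^ 2 + 5 / 3 * A1 q * A2 q ^ 3 - 5 / 9 * A2 q ^ 4) q"
proof -
  define S where "S = ball (0::complex) 1 - {0}"
  have S: "open S" "q \<in> S" using assms by (auto simp: S_def)
  define a b e where "a = A1 q" and "b = A2 q" and "e = E2 q"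
  define da db where "da = dwp q zeta5" and "db = dwp q (zeta5 ^ 2)"
  have ea: "has_euler_deriv A1 da q" and eb: "has_euler_deriv A2 db q"
    using rho_euler[OF assms(2) zeta5_annulus[OF assms(2), of 1]] rho_euler[OF assms(2) zeta5_annulus[OF assms(2), of 2]]
    by (simp_all add: A1_def[abs_def] A2_def[abs_def] da_def db_def)
  have dr: "has_euler_deriv (\<lambda>q. drho q zeta5) (ddwp q zeta5) q"
    using drho_euler[OF assms(2) zeta5_annulus[OF assms(2), of 1]] by simp
  have "has_euler_deriv (\<lambda>q. drho q zeta5 - (- 1 / 12 + ((7 / 3) * (A1 q * A1 q) - 4 * (A1 q * A2 q) - (2 / 3) * (A2 q * A2 q))))
     (ddwp q zeta5 - (0 + ((7 / 3) * (da * A1 q + A1 q * da) - 4 * (da * A2 q + A1 q * db) - (2 / 3) * (db * A2 q + A2 q * db)))) q"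
    by (intro euler_deriv_add euler_deriv_diff euler_deriv_const euler_deriv_cmult euler_deriv_mult ea eb dr)
  then have "has_euler_deriv E2
     (ddwp q zeta5 - (0 + ((7 / 3) * (da * A1 q + A1 q * da) - 4 * (da * A2 q + A1 q * db) - (2 / 3) * (db * A2 q + A2 q * db)))) q"
  proof (rule euler_deriv_transform[OF _ S])
    fix p assume "p \<in> S"
    then have p: "p \<noteq> 0" "norm p < 1" by (auto simp: S_def)
    show "drho p zeta5 - (- 1 / 12 + ((7 / 3) * (A1 p * A1 p) - 4 * (A1 p * A2 p) - (2 / 3) * (A2 p * A2 p))) = E2 p"
      unfolding drho_zeta5[OF p] wp_zeta5[OF p] by (simp add: power2_eq_square field_simps)
  qed
  moreover have "ddwp q zeta5 - (0 + ((7 / 3) * (da * A1 q + A1 q * da) - 4 * (da * A2 q + A1 q * db) - (2 / 3) * (db * A2 q + A2 q * db)))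
     = - 1 / 144 + E2 q / 6 - E2 q ^ 2 - 5 / 9 * A1 q ^ 4 - 5 / 3 * A1 q ^ 3 * A2 q
      + 155 / 9 * A1 q ^ 2 * A2 q ^ 2 + 5 / 3 * A1 q * A2 q ^ 3 - 5 / 9 * A2 q ^ 4"
    unfolding da_def db_def ddwp_zeta5[OF assms] drho_zeta5[OF assms] dwp_zeta5[OF assms] wp_zeta5[OF assms]
      a_def[symmetric] b_def[symmetric] e_def[symmetric]
    by (simp add: divide_simps) algebra
  ultimately show ?thesis by simp
qed

section \<open>The infinite products\<close>

lemma has_sum_geometric:
  fixes c :: complex
  assumes "norm c < 1"
  shows "((\<lambda>n. c ^ n) has_sum (1 / (1 - c))) UNIV"
proof -
  have "summable (\<lambda>n. norm (c ^ n))"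
    unfolding norm_power using assms by (intro summable_geometric) auto
  then show ?thesis
    by (rule norm_summable_imp_has_sum[OF _ geometric_sums[OF assms]])
qed

lemma Ln_one_minus_has_sum:
  fixes w :: complex
  assumes "norm w < 1"
  shows "((\<lambda>m. - (w ^ Suc m / of_nat (Suc m))) has_sum ln (1 - w)) UNIV"
proof (rule norm_summable_imp_has_sum)
  have "summable (\<lambda>m. norm (w ^ m))" unfolding norm_power using assms by (intro summable_geometric) auto
  then show "summable (\<lambda>m. norm (- (w ^ Suc m / of_nat (Suc m))))"
  proof (rule summable_comparison_test'[where N = 0])
    fix m :: nat
    have "norm w ^ Suc m \<le> norm w ^ m" using assms by (intro power_decreasing) auto
    then have "norm w ^ Suc m / real (Suc m) \<le> norm w ^ m / 1"
      by (intro frac_le) auto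
    moreover have "norm (- (w ^ Suc m / of_nat (Suc m))) = norm w ^ Suc m / real (Suc m)"
      by (simp only: norm_minus_cancel norm_divide norm_power norm_of_nat)
    ultimately show "norm (norm (- (w ^ Suc m / of_nat (Suc m)))) \<le> norm (w ^ m)"
      unfolding real_norm_def abs_norm_cancel norm_power[of w] by simp
  qed
  have "(\<lambda>n. - (w ^ n) / of_nat n) sums ln (1 - w)"
    using Ln_series'[of "- w"] assms by simp
  then show "(\<lambda>m. - (w ^ Suc m / of_nat (Suc m))) sums ln (1 - w)"
    using sums_Suc_iff[of "\<lambda>n. - (w ^ n) / of_nat n" "ln (1 - w)"] by (simp del: of_nat_Suc power_Suc)
qed

text \<open>
  Expanding every logarithm and summing over \<open>n\<close> first gives geometric series in \<open>q^m\<close>; the double series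
  converges absolutely, being dominated by the product of two geometric series.
\<close>

lemma Ln_sums_lambert:
  assumes q: "norm q < 1" and x: "norm (q * x) < 1"
  shows "(\<lambda>n. ln (1 - x * q ^ Suc n)) sums (- lambert 1 (-1) q x)"
proof -
  define f where "f = (\<lambda>(m, n). - ((x * q ^ Suc n) ^ Suc m / of_nat (Suc m)))"
  have bound: "norm ((x * q ^ Suc n) ^ Suc m) \<le> norm (x * q) ^ m * norm q ^ n" for m n
  proof -
    have "norm ((x * q ^ Suc n) ^ Suc m) = norm (x * q) ^ Suc m * (norm q ^ n) ^ Suc m"
      by (simp add: norm_mult norm_power power_mult_distrib)
    also have "\<dots> \<le> norm (x * q) ^ m * (norm q ^ n) ^ 1"
      using q x by (intro mult_mono power_decreasing) (auto simp: power_le_one norm_mult mult_ac)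
    finally show ?thesis by simp
  qed
  have inner: "((\<lambda>n. f (m, n)) has_sum - lambert_term 1 (-1) q x m) UNIV" for m
  proof -
    have qm: "norm (q ^ Suc m) < 1" using q by (simp add: norm_power power_less_one_iff del: power_Suc)
    have "((\<lambda>n. - ((x * q) ^ Suc m / of_nat (Suc m)) * (q ^ Suc m) ^ n)
        has_sum - ((x * q) ^ Suc m / of_nat (Suc m)) * (1 / (1 - q ^ Suc m))) UNIV"
      by (intro has_sum_cmult_right has_sum_geometric qm)
    moreover have "- ((x * q) ^ Suc m / of_nat (Suc m)) * (q ^ Suc m) ^ n = f (m, n)" for n
    proof -
      have "x * q ^ Suc n = (x * q) * q ^ n" by simp
      then have e: "(x * q ^ Suc n) ^ Suc m = (x * q) ^ Suc m * (q ^ Suc m) ^ n"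
        by (simp only: power_mult_distrib power_mult[symmetric] mult.commute)
      show ?thesis unfolding f_def prod.case e by (simp only: mult_minus_left times_divide_eq_left)
    qed
    moreover have "- ((x * q) ^ Suc m / of_nat (Suc m)) * (1 / (1 - q ^ Suc m)) = - lambert_term 1 (-1) q x m"
      by (simp add: lambert_term_def power_mult_distrib divide_inverse power_int_minus mult_ac del: of_nat_Suc power_Suc)
    ultimately show ?thesis by simp
  qed
  have outer: "((\<lambda>m. f (m, n)) has_sum ln (1 - x * q ^ Suc n)) UNIV" for n
  proof -
    have "norm (x * q ^ Suc n) = norm (x * q) * norm q ^ n" by (simp add: norm_mult norm_power)
    also have "\<dots> \<le> norm (x * q) * 1" using q by (intro mult_left_mono power_le_one) auto
    also have "\<dots> < 1" using x by (simp add: mult.commute)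
    finally show ?thesis unfolding f_def prod.case by (rule Ln_one_minus_has_sum)
  qed
  have "(\<lambda>p. norm (f p)) summable_on (UNIV \<times> UNIV)"
  proof (rule Infinite_Sum.abs_summable_on_comparison_test)
    have xq: "norm (x * q) < 1" using x by (simp add: mult.commute)
    have n: "((\<lambda>n. norm c ^ n) has_sum (1 / (1 - norm c))) UNIV" if "norm c < 1" for c :: complex
      using norm_summable_imp_has_sum[of "\<lambda>n. norm c ^ n"] geometric_sums[of "norm c"] that
      by (auto intro: summable_geometric)
    have "(\<lambda>(m, n). norm (x * q) ^ m * norm q ^ n) summable_on (UNIV \<times> UNIV)"
    proof (rule summable_on_SigmaI[where g = "\<lambda>m. norm (x * q) ^ m * (1 / (1 - norm q))"])
      show "((\<lambda>n. case (m, n) of (m, n) \<Rightarrow> norm (x * q) ^ m * norm q ^ n)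
          has_sum norm (x * q) ^ m * (1 / (1 - norm q))) UNIV" for m
        unfolding prod.case by (rule has_sum_cmult_right[OF n[OF q]])
      show "(\<lambda>m. norm (x * q) ^ m * (1 / (1 - norm q))) summable_on UNIV"
        by (rule summable_on_cmult_left[OF has_sum_imp_summable[OF n[OF xq]]])
    qed simp
    then show "(\<lambda>p. norm (case p of (m, n) \<Rightarrow> norm (x * q) ^ m * norm q ^ n)) summable_on (UNIV \<times> UNIV)"
      by (rule summable_on_cong[THEN iffD1, rotated]) (auto simp: abs_mult)
    fix p :: "nat \<times> nat"
    obtain m n where p: "p = (m, n)" by (cases p)
    have "norm (f p) = norm ((x * q ^ Suc n) ^ Suc m) / real (Suc m)"
      unfolding p f_def prod.case norm_minus_cancel norm_divide norm_of_nat ..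
    also have "\<dots> \<le> norm ((x * q ^ Suc n) ^ Suc m) / 1" by (intro divide_left_mono) auto
    also have "\<dots> \<le> norm (x * q) ^ m * norm q ^ n" using bound by simp
    finally show "norm (f p) \<le> norm (case p of (m, n) \<Rightarrow> norm (x * q) ^ m * norm q ^ n)"
      unfolding p by (simp add: abs_mult)
  qed
  then have "f summable_on (UNIV \<times> UNIV)" by (rule Infinite_Sum.abs_summable_summable)
  then obtain S where S: "(f has_sum S) (UNIV \<times> UNIV)" by (auto simp: summable_on_def)
  have 1: "((\<lambda>m. - lambert_term 1 (-1) q x m) has_sum S) UNIV"
    by (rule has_sum_Sigma'[OF S]) (rule inner)
  have "(\<lambda>m. - lambert_term 1 (-1) q x m) sums (- lambert 1 (-1) q x)"
    by (intro sums_minus lambert_sums q x)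
  then have SS: "S = - lambert 1 (-1) q x" using has_sum_imp_sums[OF 1] by (rule sums_unique2[symmetric])
  have "((\<lambda>(n, m). f (m, n)) has_sum S) (UNIV \<times> UNIV)"
    using S by (subst has_sum_swap[symmetric]) (simp add: case_prod_unfold)
  then have "((\<lambda>n. ln (1 - x * q ^ Suc n)) has_sum S) UNIV"
    by (rule has_sum_Sigma') (use outer in auto)
  then show ?thesis unfolding SS by (rule has_sum_imp_sums)
qed

text \<open>
  A logarithm of one factor of the theta product, such that the sum of these logarithms converges and the
  infinite product can be evaluated as an exponential.
\<close>

definition theta_log :: "complex \<Rightarrow> complex \<Rightarrow> nat \<Rightarrow> complex" where
  "theta_log q x n = ln (1 - x * q ^ Suc n) + ln (1 - inverse x * q ^ Suc n)"

lemma theta_log_sums: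
  assumes "norm q < 1" "x \<in> annulus q"
  shows "theta_log q x sums (- qlog q x)"
  using sums_add[OF Ln_sums_lambert[OF assms(1) annulusD(2)[OF assms(2)]]
      Ln_sums_lambert[OF assms(1) annulusD(3)[OF assms(2)]]]
  by (simp add: theta_log_def[abs_def] qlog_def)

lemma exp_theta_log:
  assumes "norm q < 1" "norm x = 1"
  shows "exp (theta_log q x n) = 1 - (x + inverse x) * q ^ Suc n + (q ^ Suc n) ^ 2"
proof -
  define u where "u = q ^ Suc n"
  have u: "norm u < 1" using assms by (simp add: u_def norm_power power_less_one_iff del: power_Suc)
  have nz: "1 - y * u \<noteq> 0" if "norm y = 1" for y
  proof
    assume "1 - y * u = 0"
    then have "norm (y * u) = 1" by (metis norm_one right_minus_eq)
    then show False using u that by (simp add: norm_mult)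
  qed
  have "exp (theta_log q x n) = (1 - x * u) * (1 - inverse x * u)"
    unfolding theta_log_def u_def[symmetric] exp_add using nz[of x] nz[of "inverse x"] assms
    by (simp add: norm_inverse)
  also have "\<dots> = 1 - (x + inverse x) * u + (x * inverse x) * u ^ 2"
    by algebra
  also have "x * inverse x = 1" using assms by (intro right_inverse) auto
  finally show ?thesis by (simp add: u_def)
qed

definition F_nome :: "complex \<Rightarrow> complex" where
  "F_nome q = fsing_plus * exp (5 * (qlog q zeta5 - qlog q (zeta5 ^ 2)))"

definition S_nome :: "complex \<Rightarrow> complex" where
  "S_nome q = exp (3 * qlog q (zeta5 ^ 2) - (qlog q 1 + 2 * qlog q zeta5))"

lemma norm_nome: "\<tau> \<in> upper_half_plane \<Longrightarrow> norm (nome \<tau>) < 1"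
  by (simp add: nome_def upper_half_plane_def)

lemma product_factors:
  assumes q: "norm q < 1"
  shows "1 + of_real ((1 - sqrt 5) / 2) * q ^ Suc n + q ^ (2 * Suc n) = exp (theta_log q zeta5 n)"
    "1 + of_real ((1 + sqrt 5) / 2) * q ^ Suc n + q ^ (2 * Suc n) = exp (theta_log q (zeta5 ^ 2) n)"
    "(1 - q ^ Suc n) ^ 2 = exp (theta_log q 1 n)"
proof -
  have m: "q ^ (2 * Suc n) = (q ^ Suc n) ^ 2" by (simp only: power_mult[symmetric] mult.commute)
  show "1 + of_real ((1 - sqrt 5) / 2) * q ^ Suc n + q ^ (2 * Suc n) = exp (theta_log q zeta5 n)"
    unfolding exp_theta_log[OF q norm_zeta5] zeta5_trace m
    by (simp add: field_simps del: power_Suc)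
  have z2: "norm (zeta5 ^ 2) = 1" by (simp add: norm_power norm_zeta5)
  show "1 + of_real ((1 + sqrt 5) / 2) * q ^ Suc n + q ^ (2 * Suc n) = exp (theta_log q (zeta5 ^ 2) n)"
    unfolding exp_theta_log[OF q z2] zeta5_square_trace m
    by (simp add: field_simps del: power_Suc)
  show "(1 - q ^ Suc n) ^ 2 = exp (theta_log q 1 n)"
    unfolding exp_theta_log[OF q norm_one]
    by (simp add: power2_eq_square algebra_simps del: power_Suc)
qed

text \<open>
  Over the field of \<open>sqrt 5\<close> the fifth cyclotomic polynomial splits into two quadratic factors. It removes the
  products over \<open>q^(5 n)\<close> from \<open>S\<close>.
\<close>

lemma cyclotomic_factorisation:
  fixes u :: complex
  shows "1 - u ^ 5 = (1 - u) * ((1 + of_real ((1 - sqrt 5) / 2) * u + u ^ 2) * (1 + of_real ((1 + sqrt 5) / 2) * u + u ^ 2))"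
proof -
  define s where "s = complex_of_real (sqrt 5)"
  have s: "s ^ 2 = 5" unfolding s_def of_real_power[symmetric] by simp
  have e: "of_real ((1 - sqrt 5) / 2) = (1 - s) / 2" "of_real ((1 + sqrt 5) / 2) = (1 + s) / 2"
    by (simp_all add: s_def)
  have "(1 + (1 - s) / 2 * u + u ^ 2) * (1 + (1 + s) / 2 * u + u ^ 2) = (1 + u / 2 + u ^ 2) ^ 2 - s ^ 2 * u ^ 2 / 4"
    by (simp add: divide_simps) algebra
  moreover have "1 - u ^ 5 = (1 - u) * ((1 + u / 2 + u ^ 2) ^ 2 - 5 * u ^ 2 / 4)"
    by (simp add: divide_simps) algebra
  ultimately show ?thesis unfolding e s by simp
qed

lemma f_mod_eq:
  assumes "\<tau> \<in> upper_half_plane"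
  shows "f_mod \<tau> = F_nome (nome \<tau>)"
proof -
  define q where "q = nome \<tau>"
  have q: "norm q < 1" using norm_nome[OF assms] by (simp add: q_def)
  define h where "h = (\<lambda>n. 5 * (theta_log q (zeta5 ^ 2) n - theta_log q zeta5 n))"
  have h: "h sums (5 * (- qlog q (zeta5 ^ 2) - - qlog q zeta5))"
    unfolding h_def
    using zeta5_annulus[OF q, of 1] zeta5_annulus[OF q, of 2]
    by (intro sums_mult sums_diff theta_log_sums q) simp_all
  have "(1 + of_real ((1 + sqrt 5) / 2) * q ^ Suc n + q ^ (2 * Suc n)) ^ 5 /
        (1 + of_real ((1 - sqrt 5) / 2) * q ^ Suc n + q ^ (2 * Suc n)) ^ 5 = exp (h n)" for n
    unfolding product_factors[OF q] h_def exp_of_nat_mult[of 5, simplified, symmetric]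
    by (simp add: exp_diff power_divide exp_of_nat_mult[of 5, simplified])
  then have "f_mod \<tau> = fsing_plus * (\<Prod>n. exp (h n))"
    unfolding f_mod_def Let_def q_def[symmetric] by simp
  also have "(\<Prod>n. exp (h n)) = exp (5 * (- qlog q (zeta5 ^ 2) - - qlog q zeta5))"
    using prodinf_exp[OF sums_summable[OF h]] sums_unique[OF h] by simp
  finally show ?thesis by (simp add: F_nome_def q_def)
qed

lemma S_mod_eq:
  assumes "\<tau> \<in> upper_half_plane"
  shows "S_mod \<tau> = of_real (sqrt (250 - 110 * sqrt 5) / 5) * S_nome (nome \<tau>)"
proof -
  define q where "q = nome \<tau>"
  have q: "norm q < 1" using norm_nome[OF assms] by (simp add: q_def)
  define h where "h = (\<lambda>n. (theta_log q 1 n + 2 * theta_log q zeta5 n) - 3 * theta_log q (zeta5 ^ 2) n)"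
  have h: "h sums ((- qlog q 1 + 2 * - qlog q zeta5) - 3 * - qlog q (zeta5 ^ 2))"
    unfolding h_def
    using zeta5_annulus[OF q, of 0] zeta5_annulus[OF q, of 1] zeta5_annulus[OF q, of 2]
    by (intro sums_mult sums_diff sums_add theta_log_sums q) simp_all
  have "(1 - q ^ Suc n) ^ 5 / (1 - q ^ (5 * Suc n)) ^ 3 *
        (1 + of_real ((1 - sqrt 5) / 2) * q ^ Suc n + q ^ (2 * Suc n)) ^ 5 = exp (h n)" for n
  proof -
    define u where "u = q ^ Suc n"
    define x y where "x = exp (theta_log q zeta5 n)" and "y = exp (theta_log q (zeta5 ^ 2) n)"
    have nz: "x \<noteq> 0" "y \<noteq> 0" "1 - u \<noteq> 0"
      using one_minus_power_nonzero[OF q] by (simp_all add: x_def y_def u_def del: power_Suc)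
    have u2: "q ^ (2 * Suc n) = u ^ 2" "q ^ (5 * Suc n) = u ^ 5"
      by (simp_all only: u_def power_mult[symmetric] mult.commute)
    have fac: "1 + of_real ((1 - sqrt 5) / 2) * u + u ^ 2 = x" "1 + of_real ((1 + sqrt 5) / 2) * u + u ^ 2 = y"
      using product_factors[OF q, of n] unfolding u2 u_def[symmetric] x_def y_def by blast+
    have "exp (h n) = (1 - u) ^ 2 * x ^ 2 / y ^ 3"
      unfolding h_def exp_diff exp_add product_factors(3)[OF q, symmetric] x_def y_def u_def
      by (simp add: exp_of_nat_mult[of 2, simplified] exp_of_nat_mult[of 3, simplified])
    also have "\<dots> = (1 - u) ^ 5 / ((1 - u) * (x * y)) ^ 3 * x ^ 5"
      using nz by (simp add: divide_simps) (simp add: power_mult_distrib eval_nat_numeral mult_ac)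
    finally show ?thesis unfolding u2 u_def[symmetric] cyclotomic_factorisation[of u] fac by simp
  qed
  then have "S_mod \<tau> = of_real (sqrt (250 - 110 * sqrt 5) / 5) * (\<Prod>n. exp (h n))"
    unfolding S_mod_def Let_def q_def[symmetric] by simp
  also have "(\<Prod>n. exp (h n)) = exp ((- qlog q 1 + 2 * - qlog q zeta5) - 3 * - qlog q (zeta5 ^ 2))"
    using prodinf_exp[OF sums_summable[OF h]] sums_unique[OF h] by simp
  finally show ?thesis by (simp add: S_nome_def q_def algebra_simps)
qed

section \<open>The modular function as a quotient of two linear forms\<close>

lemma lambert_0: "lambert j k 0 x = 0"
  by (simp add: lambert_def lambert_term_def)

lemma euler_deriv_zero_imp_const:
  assumes "\<And>q. norm q < 1 \<Longrightarrow> has_euler_deriv h 0 q" "norm q < 1"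
  shows "h q = h 0"
proof -
  have d: "\<exists>d. (h has_field_derivative d) (at p) \<and> p * d = 0" if "p \<in> ball 0 1" for p
    using assms(1)[of p] that by (auto simp: has_euler_deriv_def)
  have "continuous_on (ball 0 1) h"
    using d by (intro continuous_at_imp_continuous_on ballI) (blast intro: DERIV_isCont)
  moreover have "\<forall>p\<in>ball 0 1 - {0}. DERIV h p :> 0" using d by fastforce
  ultimately obtain c where "\<And>p. p \<in> ball 0 1 \<Longrightarrow> h p = c"
    using DERIV_zero_connected_constant[OF connected_ball open_ball, of "{0}" 0 1 h] by auto
  then show ?thesis using assms(2) by simp
qed

text \<open>
  Solutions of a first order linear equation on the whole unit disc are determined by their value at \<open>q = 0\<close>,
  although the operator \<open>q d/dq\<close> degenerates there: the quotient of two solutions is constant on the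
  punctured disc and continuous.
\<close>

lemma euler_deriv_linear_solution:
  assumes h: "\<And>q. norm q < 1 \<Longrightarrow> has_euler_deriv h (h q * v q) q"
    and E: "\<And>q. norm q < 1 \<Longrightarrow> has_euler_deriv E (v q) q"
    and q: "norm q < 1" and E0: "E 0 = 0"
  shows "h q = h 0 * exp (E q)"
proof -
  have "h q * exp (- 1 * E q) = h 0 * exp (- 1 * E 0)"
  proof (rule euler_deriv_zero_imp_const[OF _ q])
    fix p :: complex assume p: "norm p < 1"
    have "has_euler_deriv (\<lambda>p. h p * exp (- 1 * E p))
        (h p * v p * exp (- 1 * E p) + h p * (exp (- 1 * E p) * (- 1 * v p))) p"
      by (intro euler_deriv_mult euler_deriv_exp euler_deriv_cmult h E p)
    then show "has_euler_deriv (\<lambda>p. h p * exp (- 1 * E p)) 0 p" by simp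
  qed
  then have "h q * (exp (- E q) * exp (E q)) = h 0 * exp (E q)" using E0 by simp
  then show ?thesis by (simp add: exp_minus)
qed

definition L5 :: "complex \<Rightarrow> complex" where "L5 q = A1 q - 3 * A2 q"
definition M5 :: "complex \<Rightarrow> complex" where "M5 q = 3 * A1 q + A2 q"
definition V5 :: "complex \<Rightarrow> complex" where "V5 q = A1 q ^ 2 - 4 * A1 q * A2 q - A2 q ^ 2"
text \<open>
  The logarithmic derivative of \<open>S\<close> under \<open>q d/dq\<close>.
\<close>

definition G5 :: "complex \<Rightarrow> complex" where
  "G5 q = 1 / 12 - E2 q - 7 / 3 * A1 q ^ 2 + 10 * A1 q * A2 q + 8 / 3 * A2 q ^ 2"

lemma wp_combinations:
  assumes "q \<noteq> 0" "norm q < 1"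
  shows "wp q zeta5 - wp q (zeta5 ^ 2) = V5 q"
    "3 * wp q (zeta5 ^ 2) - (wp q 1 + 2 * wp q zeta5) = G5 q"
  unfolding wp_zeta5[OF assms] V5_def G5_def E2_def by (simp_all add: divide_simps algebra_simps)

lemma A1_A2_euler:
  assumes "norm q < 1"
  shows "has_euler_deriv A1 (dwp q zeta5) q" "has_euler_deriv A2 (dwp q (zeta5 ^ 2)) q"
  using rho_euler[OF assms zeta5_annulus[OF assms, of 1]] rho_euler[OF assms zeta5_annulus[OF assms, of 2]]
  by (simp_all add: A1_def[abs_def] A2_def[abs_def])

lemma L5_euler:
  assumes "norm q < 1"
  shows "has_euler_deriv L5 (L5 q * (3 * wp q (zeta5 ^ 2) - (wp q 1 + 2 * wp q zeta5))) q"
proof -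
  have *: "has_euler_deriv L5 (dwp q zeta5 - 3 * dwp q (zeta5 ^ 2)) q"
    unfolding L5_def[abs_def] by (intro euler_deriv_diff euler_deriv_cmult A1_A2_euler assms)
  have "dwp q zeta5 - 3 * dwp q (zeta5 ^ 2) = L5 q * (3 * wp q (zeta5 ^ 2) - (wp q 1 + 2 * wp q zeta5))"
  proof (cases "q = 0")
    case True
    then show ?thesis by (simp add: dwp_def wp_def lambert_0)
  next
    case False
    show ?thesis unfolding wp_combinations[OF False assms] dwp_zeta5[OF False assms] L5_def G5_def
      by (simp add: divide_simps) algebra
  qed
  then show ?thesis using * by simp
qed

lemma M5_euler:
  assumes "norm q < 1"
  shows "has_euler_deriv M5 (M5 q * (3 * wp q (zeta5 ^ 2) - (wp q 1 + 2 * wp q zeta5)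
            + 5 * (wp q zeta5 - wp q (zeta5 ^ 2)))) q"
proof -
  have *: "has_euler_deriv M5 (3 * dwp q zeta5 + dwp q (zeta5 ^ 2)) q"
    unfolding M5_def[abs_def] by (intro euler_deriv_add euler_deriv_cmult A1_A2_euler assms)
  have "3 * dwp q zeta5 + dwp q (zeta5 ^ 2) = M5 q * (3 * wp q (zeta5 ^ 2) - (wp q 1 + 2 * wp q zeta5)
            + 5 * (wp q zeta5 - wp q (zeta5 ^ 2)))"
  proof (cases "q = 0")
    case True
    then show ?thesis by (simp add: dwp_def wp_def lambert_0)
  next
    case False
    show ?thesis unfolding wp_combinations[OF False assms] dwp_zeta5[OF False assms] M5_def G5_def V5_def
      by (simp add: divide_simps) algebra
  qed
  then show ?thesis using * by simp
qed

lemma qlog_0: "qlog 0 x = 0"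
  by (simp add: qlog_def lambert_0)

lemma one_annulus: "norm q < 1 \<Longrightarrow> 1 \<in> annulus q"
  by (rule unimodular_annulus) simp_all

lemma L5_eq:
  assumes "norm q < 1"
  shows "L5 q = L5 0 * S_nome q"
  unfolding S_nome_def
proof (rule euler_deriv_linear_solution[OF L5_euler _ assms])
  show "has_euler_deriv (\<lambda>q. 3 * qlog q (zeta5 ^ 2) - (qlog q 1 + 2 * qlog q zeta5))
      (3 * wp p (zeta5 ^ 2) - (wp p 1 + 2 * wp p zeta5)) p" if p: "norm p < 1" for p
    using zeta5_annulus[OF p, of 1] zeta5_annulus[OF p, of 2]
    by (intro euler_deriv_add euler_deriv_diff euler_deriv_cmult qlog_euler one_annulus p) simp_all
qed (simp_all add: qlog_0)

lemma M5_eq: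
  assumes "norm q < 1"
  shows "M5 q = M5 0 * exp (3 * qlog q (zeta5 ^ 2) - (qlog q 1 + 2 * qlog q zeta5)
            + 5 * (qlog q zeta5 - qlog q (zeta5 ^ 2)))"
proof (rule euler_deriv_linear_solution[OF M5_euler _ assms])
  show "has_euler_deriv (\<lambda>q. 3 * qlog q (zeta5 ^ 2) - (qlog q 1 + 2 * qlog q zeta5)
        + 5 * (qlog q zeta5 - qlog q (zeta5 ^ 2)))
      (3 * wp p (zeta5 ^ 2) - (wp p 1 + 2 * wp p zeta5) + 5 * (wp p zeta5 - wp p (zeta5 ^ 2))) p"
    if p: "norm p < 1" for p
    using zeta5_annulus[OF p, of 1] zeta5_annulus[OF p, of 2]
    by (intro euler_deriv_add euler_deriv_diff euler_deriv_cmult qlog_euler one_annulus p) simp_all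
qed (simp_all add: qlog_0)

text \<open>
  At \<open>q = 0\<close> only the rational parts \<open>(1 + x) / (2 (1 - x))\<close> of \<open>rho\<close> survive, and
  \<open>z\<^sup>2 + 1 = z (sqrt 5 - 1) / 2\<close> for \<open>z = zeta5\<close>.
\<close>

lemma values_at_0:
  "A1 0 = (2 + of_real (sqrt 5)) * A2 0" "A2 0 \<noteq> 0"
proof -
  define s where "s = complex_of_real (sqrt 5)"
  have s: "s ^ 2 = 5" unfolding s_def of_real_power[symmetric] by simp
  define z where "z = zeta5"
  have z: "z \<noteq> 0" "1 - z \<noteq> 0" "1 - z ^ 2 \<noteq> 0"
    using zeta5_nonzero zeta5_neq_1 zeta5_powers_neq_1 by (auto simp: z_def)
  have "z + inverse z = (s - 1) / 2" using zeta5_trace by (simp add: z_def s_def)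
  then have t: "2 * (z ^ 2 + 1) = (s - 1) * z"
    using z by (simp add: field_simps power2_eq_square)
  have s1: "s - 1 \<noteq> 0"
  proof
    assume "s - 1 = 0"
    then have "s = 1" by simp
    then show False using s by simp
  qed
  have nz: "1 + z ^ 2 \<noteq> 0"
  proof
    assume "1 + z ^ 2 = 0"
    then have "2 * (z ^ 2 + 1) = 0" by (simp add: add.commute)
    then show False unfolding t using s1 z by simp
  qed
  have a: "A1 0 = (1 + z) / (2 * (1 - z))" "A2 0 = (1 + z ^ 2) / (2 * (1 - z ^ 2))"
    by (simp_all add: A1_def A2_def rho_def lambert_0 z_def)
  show "A2 0 \<noteq> 0" unfolding a using nz z by simp
  have "2 * (1 + z) ^ 2 = 2 * (z ^ 2 + 1) + 4 * z" by algebra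
  also have "\<dots> = (5 + s - 2) * z" unfolding t by (simp add: algebra_simps)
  also have "\<dots> = (2 + s) * ((s - 1) * z)" unfolding s[symmetric] by algebra
  also have "\<dots> = 2 * ((2 + s) * (1 + z ^ 2))" unfolding t[symmetric] by (simp add: algebra_simps)
  finally have "2 * (1 + z) ^ 2 = 2 * ((2 + s) * (1 + z ^ 2))" .
  then have sq: "(2 + s) * (1 + z ^ 2) = (1 + z) ^ 2"
    unfolding mult_cancel_left by auto
  have fac: "1 - z ^ 2 = (1 - z) * (1 + z)" by (simp add: power2_eq_square algebra_simps)
  have zp: "1 + z \<noteq> 0" using fac z(3) by auto
  have "(2 + s) * ((1 + z ^ 2) / (2 * (1 - z ^ 2))) = (1 + z) ^ 2 / (2 * ((1 - z) * (1 + z)))"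
    unfolding times_divide_eq_right sq fac ..
  also have "\<dots> = (1 + z) / (2 * (1 - z))"
    using z(2) zp by (simp add: power2_eq_square)
  finally show "A1 0 = (2 + of_real (sqrt 5)) * A2 0"
    unfolding a s_def[symmetric] by simp
qed

lemma fsing_roots:
  "(w - fsing_plus) * (w - fsing_minus) = w ^ 2 - 11 * w - 1"
proof -
  define s where "s = complex_of_real (sqrt 5)"
  have s: "s ^ 2 = 5" unfolding s_def of_real_power[symmetric] by simp
  have f: "fsing_plus = (11 + 5 * s) / 2" "fsing_minus = (11 - 5 * s) / 2"
    by (simp_all add: fsing_plus_def fsing_minus_def s_def)
  have "(w - (11 + 5 * s) / 2) * (w - (11 - 5 * s) / 2) = w ^ 2 - 11 * w + (121 - 25 * s ^ 2) / 4"
    by (simp add: divide_simps) algebra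
  then show ?thesis unfolding f s by simp
qed

lemma fsing_plus_nonzero: "fsing_plus \<noteq> 0"
  using fsing_roots[of 0] by auto

lemma M5_L5_at_0: "M5 0 = fsing_plus * L5 0" "L5 0 \<noteq> 0"
proof -
  define s where "s = complex_of_real (sqrt 5)"
  have s: "s ^ 2 = 5" unfolding s_def of_real_power[symmetric] by simp
  have f: "fsing_plus = (11 + 5 * s) / 2" by (simp add: fsing_plus_def s_def)
  have s1: "s - 1 \<noteq> 0"
  proof
    assume "s - 1 = 0"
    then have "s = 1" by simp
    then show False using s by simp
  qed
  have L: "L5 0 = (s - 1) * A2 0" and M: "M5 0 = (7 + 3 * s) * A2 0"
    by (simp_all add: L5_def M5_def values_at_0(1) s_def algebra_simps)
  show "L5 0 \<noteq> 0" unfolding L using values_at_0(2) s1 by simp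
  have "(11 + 5 * s) / 2 * (s - 1) = (5 * s ^ 2 + 6 * s - 11) / 2" by (simp add: divide_simps) algebra
  then have "7 + 3 * s = (11 + 5 * s) / 2 * (s - 1)" unfolding s by simp
  then show "M5 0 = fsing_plus * L5 0" unfolding L M f by simp
qed

lemma L5_nonzero:
  assumes "norm q < 1"
  shows "L5 q \<noteq> 0"
  unfolding L5_eq[OF assms] S_nome_def using M5_L5_at_0(2) by simp

lemma F_nome_eq:
  assumes "norm q < 1"
  shows "F_nome q * L5 q = M5 q"
  unfolding L5_eq[OF assms] M5_eq[OF assms] M5_L5_at_0 F_nome_def S_nome_def exp_add by simp

lemma F_nome_nonzero: "F_nome q \<noteq> 0"
  by (simp add: F_nome_def fsing_plus_nonzero)

lemma F_nome_euler:
  assumes "q \<noteq> 0" "norm q < 1"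
  shows "has_euler_deriv F_nome (5 * F_nome q * V5 q) q"
proof -
  have "has_euler_deriv F_nome (fsing_plus * (exp (5 * (qlog q zeta5 - qlog q (zeta5 ^ 2)))
       * (5 * (wp q zeta5 - wp q (zeta5 ^ 2))))) q"
    unfolding F_nome_def[abs_def]
    using zeta5_annulus[OF assms(2), of 1] zeta5_annulus[OF assms(2), of 2]
    by (intro euler_deriv_cmult euler_deriv_exp euler_deriv_diff qlog_euler assms) simp_all
  then show ?thesis unfolding wp_combinations[OF assms] F_nome_def by (simp add: mult_ac)
qed

lemma V5_euler:
  assumes "q \<noteq> 0" "norm q < 1"
  shows "has_euler_deriv V5 (V5 q * (1 / 6 - 2 * E2 q - 5 / 3 * (A1 q ^ 2 + A2 q ^ 2))) q"
proof -
  define da db where "da = dwp q zeta5" and "db = dwp q (zeta5 ^ 2)"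
  note ab = A1_A2_euler[OF assms(2), folded da_def db_def]
  have "has_euler_deriv (\<lambda>q. A1 q * A1 q - 4 * (A1 q * A2 q) - A2 q * A2 q)
      ((da * A1 q + A1 q * da) - 4 * (da * A2 q + A1 q * db) - (db * A2 q + A2 q * db)) q"
    by (intro euler_deriv_diff euler_deriv_cmult euler_deriv_mult ab)
  moreover have "(\<lambda>q. A1 q * A1 q - 4 * (A1 q * A2 q) - A2 q * A2 q) = V5"
    by (simp add: V5_def fun_eq_iff power2_eq_square)
  moreover have "(da * A1 q + A1 q * da) - 4 * (da * A2 q + A1 q * db) - (db * A2 q + A2 q * db)
      = V5 q * (1 / 6 - 2 * E2 q - 5 / 3 * (A1 q ^ 2 + A2 q ^ 2))"
    unfolding da_def db_def dwp_zeta5[OF assms] V5_def by (simp add: divide_simps) algebra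
  ultimately show ?thesis by simp
qed

text \<open>
  In terms of \<open>1 / L5\<close>, whose logarithmic derivative is \<open>- G5\<close>, this is the second order equation
  \<open>D\<^sup>2 (1 / L5) = - 10 A2 M5 V5 / L5\<close>, where \<open>D = q d/dq\<close>; it is the source of the differential equation for \<open>S\<close>.
\<close>

lemma G5_euler:
  assumes "q \<noteq> 0" "norm q < 1"
  shows "has_euler_deriv G5 (G5 q ^ 2 + 10 * A2 q * M5 q * V5 q) q"
proof -
  define da db de where "da = dwp q zeta5" and "db = dwp q (zeta5 ^ 2)" and
    "de = - 1 / 144 + E2 q / 6 - E2 q ^ 2 - 5 / 9 * A1 q ^ 4 - 5 / 3 * A1 q ^ 3 * A2 q
      + 155 / 9 * A1 q ^ 2 * A2 q ^ 2 + 5 / 3 * A1 q * A2 q ^ 3 - 5 / 9 * A2 q ^ 4"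
  note ab = A1_A2_euler[OF assms(2), folded da_def db_def] E2_euler[OF assms, folded de_def]
  have "has_euler_deriv (\<lambda>q. 1 / 12 - E2 q - 7 / 3 * (A1 q * A1 q) + 10 * (A1 q * A2 q) + 8 / 3 * (A2 q * A2 q))
      (0 - de - 7 / 3 * (da * A1 q + A1 q * da) + 10 * (da * A2 q + A1 q * db) + 8 / 3 * (db * A2 q + A2 q * db)) q"
    by (intro euler_deriv_add euler_deriv_diff euler_deriv_const euler_deriv_cmult euler_deriv_mult ab)
  moreover have "(\<lambda>q. 1 / 12 - E2 q - 7 / 3 * (A1 q * A1 q) + 10 * (A1 q * A2 q) + 8 / 3 * (A2 q * A2 q)) = G5"
    by (simp add: G5_def fun_eq_iff power2_eq_square)
  moreover have "0 - de - 7 / 3 * (da * A1 q + A1 q * da) + 10 * (da * A2 q + A1 q * db) + 8 / 3 * (db * A2 q + A2 q * db)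
      = G5 q ^ 2 + 10 * A2 q * M5 q * V5 q"
    unfolding da_def db_def de_def dwp_zeta5[OF assms] V5_def M5_def G5_def by (simp add: divide_simps) algebra
  ultimately show ?thesis by simp
qed

lemma euler_deriv_holomorphic:
  assumes "open S" "\<And>q. q \<in> S \<Longrightarrow> has_euler_deriv f (v q) q"
  shows "f holomorphic_on S"
  using assms unfolding holomorphic_on_open[OF assms(1)] has_euler_deriv_def by blast

lemma A_holomorphic: "A1 holomorphic_on ball 0 1" "A2 holomorphic_on ball 0 1"
  by (rule euler_deriv_holomorphic, simp, rule A1_A2_euler, simp)+

lemma E2_holomorphic: "E2 holomorphic_on ball 0 1 - {0}"
  by (rule euler_deriv_holomorphic, force, rule E2_euler) auto

text \<open>
  By uniqueness for the first order equation of lemma \<open>V5_euler\<close>, a zero of \<open>V5\<close> forces \<open>V5\<close> to vanish near it,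
  hence on the whole disc. Then \<open>qlog q zeta5 - qlog q (zeta5 ^ 2)\<close> would be constant, but its derivative at
  \<open>q = 0\<close> is the difference \<open>sqrt 5\<close> of the two traces.
\<close>

lemma V5_nonzero:
  assumes q: "q \<noteq> 0" "norm q < 1"
  shows "V5 q \<noteq> 0"
proof
  assume zero: "V5 q = 0"
  have "open (ball 0 1 - {0::complex})" "q \<in> ball 0 1 - {0}" using q by auto
  then obtain r where r: "r > 0" "ball q r \<subseteq> ball 0 1 - {0}"
    unfolding open_contains_ball by blast
  have z0: "p \<noteq> 0" if "p \<in> ball q r" for p using r(2) that by blast
  \<comment> \<open>Near \<open>q\<close> the equation for \<open>V5\<close> is solved by the exponential of a primitive of its coefficient.\<close>
  define H where "H = (\<lambda>q. (1 / 6 - 2 * E2 q - 5 / 3 * (A1 q ^ 2 + A2 q ^ 2)) / q)"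
  have "H holomorphic_on ball q r"
    unfolding H_def using r z0[of 0]
    by (intro holomorphic_intros holomorphic_on_subset[OF E2_holomorphic]
        holomorphic_on_subset[OF A_holomorphic(1)] holomorphic_on_subset[OF A_holomorphic(2)]) auto
  then obtain \<Phi> where "\<And>p. p \<in> ball q r \<Longrightarrow> (\<Phi> has_field_derivative H p) (at p within ball q r)"
    using holomorphic_convex_primitive'[OF convex_ball open_ball] by blast
  then have \<Phi>: "(\<Phi> has_field_derivative H p) (at p)" if "p \<in> ball q r" for p
    using that at_within_open[OF _ open_ball] by metis
  have dV: "(V5 has_field_derivative V5 p * H p) (at p)" if "p \<in> ball q r" for p
  proof -
    have p: "p \<noteq> 0" "norm p < 1" using z0[OF that] that r(2) by auto
    obtain d where d: "(V5 has_field_derivative d) (at p)"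
      "p * d = V5 p * (1 / 6 - 2 * E2 p - 5 / 3 * (A1 p ^ 2 + A2 p ^ 2))"
      using V5_euler[OF p] unfolding has_euler_deriv_def by blast
    have "d = p * d / p" using p by simp
    also have "\<dots> = V5 p * H p" unfolding d(2) H_def by simp
    finally show ?thesis using d(1) by simp
  qed
  have "((\<lambda>p. V5 p * exp (- \<Phi> p)) has_field_derivative 0) (at p)" if "p \<in> ball q r" for p
    by (rule derivative_eq_intros refl dV \<Phi> that)+ (simp add: algebra_simps)
  then have "(\<lambda>p. V5 p * exp (- \<Phi> p)) constant_on ball q r"
    by (intro has_field_derivative_0_imp_constant_on) auto
  then obtain c where c: "\<And>p. p \<in> ball q r \<Longrightarrow> V5 p * exp (- \<Phi> p) = c"
    by (auto simp: constant_on_def)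
  have "c = 0" using c[of q] zero r by simp
  then have loc: "V5 p = 0" if "p \<in> ball q r" for p using c[OF that] by simp
  have V0: "V5 p = 0" if "norm p < 1" for p
  proof (rule analytic_continuation_open[of "ball q r" "ball 0 1" V5 "\<lambda>_. 0"])
    show "V5 holomorphic_on ball 0 1"
      unfolding V5_def[abs_def] by (intro holomorphic_intros A_holomorphic)
  qed (use r loc that in auto)
  define D where "D = (\<lambda>p. qlog p zeta5 - qlog p (zeta5 ^ 2))"
  have "has_euler_deriv D 0 p" if p: "norm p < 1" for p
  proof -
    have "has_euler_deriv D (wp p zeta5 - wp p (zeta5 ^ 2)) p"
      unfolding D_def using zeta5_annulus[OF p, of 1] zeta5_annulus[OF p, of 2]
      by (intro euler_deriv_diff qlog_euler p) simp_all
    moreover have "wp p zeta5 - wp p (zeta5 ^ 2) = 0"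
      using wp_combinations(1)[of p] V0[OF p] p by (cases "p = 0") (auto simp: wp_def lambert_0)
    ultimately show ?thesis by simp
  qed
  then have const: "D p = D 0" if "norm p < 1" for p using euler_deriv_zero_imp_const that by blast
  have "(D has_field_derivative 0) (at 0)"
    by (rule has_field_derivative_transform_within_open[OF DERIV_const[of "D 0"] open_ball, of _ 0 1])
       (simp, rule const[symmetric], simp)
  moreover obtain d1 where d1: "((\<lambda>q. qlog q zeta5) has_field_derivative d1) (at 0)" "d1 = zeta5 + inverse zeta5"
    using qlog_deriv_q[of 0 zeta5] zeta5_annulus[of 0 1] by auto
  moreover obtain d2 where d2: "((\<lambda>q. qlog q (zeta5 ^ 2)) has_field_derivative d2) (at 0)" "d2 = zeta5 ^ 2 + inverse (zeta5 ^ 2)"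
    using qlog_deriv_q[of 0 "zeta5 ^ 2"] zeta5_annulus[of 0 2] by auto
  ultimately have "0 = d1 - d2"
    unfolding D_def by (intro DERIV_unique[OF _ DERIV_diff[OF d1(1) d2(1)]])
  also have "\<dots> = of_real ((sqrt 5 - 1) / 2) + of_real ((sqrt 5 + 1) / 2)"
    unfolding d1(2) d2(2) zeta5_trace zeta5_square_trace by simp
  also have "\<dots> = of_real (sqrt 5)" unfolding of_real_add[symmetric] by (simp add: field_simps)
  finally show False by simp
qed

text \<open>
  Divided by \<open>L5 q ^ 2\<close>, the left-hand side is the quadratic polynomial in \<open>f\<close> whose roots are the two nonzero
  finite singular points.
\<close>

lemma M5_L5_quadratic: "M5 q ^ 2 - 11 * M5 q * L5 q - L5 q ^ 2 = - 25 * V5 q"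
  unfolding M5_def L5_def V5_def by algebra

section \<open>Passing to the variable f\<close>

lemma nome_euler:
  assumes "has_euler_deriv h v (nome \<tau>)"
  shows "((\<lambda>\<tau>. h (nome \<tau>)) has_field_derivative 2 * of_real pi * \<i> * v) (at \<tau>)"
proof -
  obtain d where d: "(h has_field_derivative d) (at (nome \<tau>))" "nome \<tau> * d = v"
    using assms unfolding has_euler_deriv_def by blast
  have "(nome has_field_derivative nome \<tau> * (2 * of_real pi * \<i>)) (at \<tau>)"
    unfolding nome_def[abs_def] by (auto intro!: derivative_eq_intros)
  from DERIV_chain2[OF d(1) this] show ?thesis
    unfolding d(2)[symmetric] by (simp add: mult_ac)
qed

lemma nome_nonzero: "nome \<tau> \<noteq> 0"
  by (simp add: nome_def)

lemma open_upper_half_plane: "open upper_half_plane"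
  unfolding upper_half_plane_def by (rule open_halfspace_Im_gt)

lemma f_mod_deriv:
  assumes "\<tau> \<in> upper_half_plane"
  shows "(f_mod has_field_derivative 2 * of_real pi * \<i> * (5 * f_mod \<tau> * V5 (nome \<tau>))) (at \<tau>)"
proof -
  have "((\<lambda>\<tau>. F_nome (nome \<tau>)) has_field_derivative
      2 * of_real pi * \<i> * (5 * F_nome (nome \<tau>) * V5 (nome \<tau>))) (at \<tau>)"
    by (intro nome_euler F_nome_euler nome_nonzero norm_nome assms)
  then show ?thesis unfolding f_mod_eq[OF assms]
    by (rule has_field_derivative_transform_within_open[OF _ open_upper_half_plane assms]) (simp add: f_mod_eq)
qed

lemma local_inverse_exists:
  assumes "\<tau> \<in> upper_half_plane"
  shows "\<exists>U g. local_inverse_branch U g \<and> f_mod \<tau> \<in> U \<and> g (f_mod \<tau>) = \<tau>"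
proof -
  have hol: "f_mod holomorphic_on upper_half_plane"
    using f_mod_deriv by (auto simp: holomorphic_on_open[OF open_upper_half_plane])
  have "deriv f_mod \<tau> \<noteq> 0"
    using DERIV_imp_deriv[OF f_mod_deriv[OF assms]] V5_nonzero[OF nome_nonzero norm_nome[OF assms]]
      f_mod_eq[OF assms] F_nome_nonzero by simp
  then obtain r where r: "r > 0" "ball \<tau> r \<subseteq> upper_half_plane" "inj_on f_mod (ball \<tau> r)"
    using has_complex_derivative_locally_injective[OF hol assms open_upper_half_plane] by blast
  have hol': "f_mod holomorphic_on ball \<tau> r" using hol r(2) by (rule holomorphic_on_subset)
  obtain g where g: "g holomorphic_on (f_mod ` ball \<tau> r)" "\<And>z. z \<in> ball \<tau> r \<Longrightarrow> g (f_mod z) = z"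
    using holomorphic_has_inverse[OF hol' open_ball r(3)] by metis
  have "open (f_mod ` ball \<tau> r)" using open_mapping_thm3[OF hol' open_ball r(3)] .
  then have "local_inverse_branch (f_mod ` ball \<tau> r) g"
    using g r by (auto simp: local_inverse_branch_def)
  moreover have "f_mod \<tau> \<in> f_mod ` ball \<tau> r" "g (f_mod \<tau>) = \<tau>" using g r by auto
  ultimately show ?thesis by blast
qed

text \<open>
  Since \<open>q d/dq\<close> of \<open>f\<close> is \<open>5 f V5\<close>, differentiation along a branch of the inverse function divides the
  Euler derivative by \<open>5 w V5\<close>.
\<close>

lemma branch_deriv:
  assumes "local_inverse_branch U g" "w \<in> U" "has_euler_deriv h v (nome (g w))"
  shows "((\<lambda>w. h (nome (g w))) has_field_derivative v / (5 * w * V5 (nome (g w)))) (at w)"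
proof -
  have U: "open U" "g holomorphic_on U" "g w \<in> upper_half_plane" "\<And>w. w \<in> U \<Longrightarrow> f_mod (g w) = w"
    using assms by (auto simp: local_inverse_branch_def)
  obtain g' where g': "(g has_field_derivative g') (at w)"
    using U assms(2) by (auto simp: holomorphic_on_open)
  define V where "V = V5 (nome (g w))"
  have nz: "V \<noteq> 0" "w \<noteq> 0"
    using V5_nonzero[OF nome_nonzero norm_nome[OF U(3)]] f_mod_eq[OF U(3)] F_nome_nonzero U(4)[OF assms(2)]
    by (auto simp: V_def)
  have "((\<lambda>w. f_mod (g w)) has_field_derivative 2 * of_real pi * \<i> * (5 * w * V) * g') (at w)"
    using DERIV_chain2[OF f_mod_deriv[OF U(3)] g'] U(4)[OF assms(2)] by (simp add: V_def)
  then have "2 * of_real pi * \<i> * (5 * w * V) * g' = 1"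
    by (rule derivatives_agree[OF _ DERIV_ident U(1) assms(2)]) (rule U(4))
  then have k: "2 * of_real pi * \<i> * g' = 1 / (5 * w * V)" using nz by (simp add: field_simps)
  have "((\<lambda>w. h (nome (g w))) has_field_derivative 2 * of_real pi * \<i> * v * g') (at w)"
    by (rule DERIV_chain2[OF nome_euler[OF assms(3)] g'])
  moreover have "2 * of_real pi * \<i> * v * g' = v * (2 * of_real pi * \<i> * g')" by simp
  ultimately show ?thesis unfolding k V_def by simp
qed

text \<open>
  With \<open>P = w (w - fsing_plus) (w - fsing_minus)\<close> the equation says that the derivative of \<open>P y'\<close> is
  \<open>- (w - 3) y\<close>. Along the branch \<open>P y'\<close> is a multiple of \<open>G5 / L5\<close>, whose derivative is \<open>2 A2\<close>.
\<close>

lemma branch_satisfies_ode: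
  assumes br: "local_inverse_branch U g"
  shows "(\<lambda>w. S_mod (g w)) holomorphic_on U"
    and "\<And>w. w \<in> U \<Longrightarrow> w \<noteq> 0 \<and> w \<noteq> fsing_plus \<and> w \<noteq> fsing_minus \<and>
     deriv (deriv (\<lambda>w. S_mod (g w))) w
       + (1 / w + 1 / (w - fsing_plus) + 1 / (w - fsing_minus)) * deriv (\<lambda>w. S_mod (g w)) w
       + (w - 3) / (w * (w - fsing_plus) * (w - fsing_minus)) * S_mod (g w) = 0"
proof -
  define Q where "Q = (\<lambda>w. nome (g w))"
  \<comment> \<open>\<open>\<kappa>\<close> is the constant with \<open>S = \<kappa> L5\<close>.\<close>
  define \<kappa> where "\<kappa> = of_real (sqrt (250 - 110 * sqrt 5) / 5) / L5 0"
  define y where "y = (\<lambda>w. S_mod (g w))"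
  define P where "P = (\<lambda>w. w * (w - fsing_plus) * (w - fsing_minus))"
  have U: "open U" using br by (simp add: local_inverse_branch_def)
  have gH: "g w \<in> upper_half_plane" "f_mod (g w) = w" if "w \<in> U" for w
    using br that by (auto simp: local_inverse_branch_def)
  have Q: "Q w \<noteq> 0" "norm (Q w) < 1" if "w \<in> U" for w
    using nome_nonzero norm_nome gH[OF that] by (auto simp: Q_def)
  have nz: "L5 (Q w) \<noteq> 0" "V5 (Q w) \<noteq> 0" if "w \<in> U" for w
    using L5_nonzero V5_nonzero Q[OF that] by auto
  have wF: "w = F_nome (Q w)" if "w \<in> U" for w
    using f_mod_eq gH[OF that] by (simp add: Q_def)
  have w0: "w \<noteq> 0" if "w \<in> U" for w using wF[OF that] F_nome_nonzero by metis
  have M: "M5 (Q w) = w * L5 (Q w)" if "w \<in> U" for w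
    using F_nome_eq[OF Q(2)[OF that]] wF[OF that] by simp
  have PL: "P w * L5 (Q w) ^ 2 = - 25 * w * V5 (Q w)" if "w \<in> U" for w
  proof -
    have "P w = w * (w ^ 2 - 11 * w - 1)" by (simp add: P_def mult.assoc fsing_roots)
    then have "P w * L5 (Q w) ^ 2 = w * ((w * L5 (Q w)) ^ 2 - 11 * (w * L5 (Q w)) * L5 (Q w) - L5 (Q w) ^ 2)"
      by algebra
    then show ?thesis using M5_L5_quadratic[of "Q w"] unfolding M[OF that] by simp
  qed
  have Pnz: "P w \<noteq> 0" if "w \<in> U" for w using PL[OF that] nz[OF that] w0[OF that] by auto
  have y: "y w = \<kappa> * L5 (Q w)" if "w \<in> U" for w
    using S_mod_eq[OF gH(1)[OF that]] L5_eq[OF Q(2)[OF that]] M5_L5_at_0(2)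
    by (simp add: y_def \<kappa>_def Q_def)
  have chain: "((\<lambda>w. h (Q w)) has_field_derivative v / (5 * w * V5 (Q w))) (at w)"
    if "w \<in> U" "has_euler_deriv h v (Q w)" for h v w
    using that unfolding Q_def by (intro branch_deriv[OF br])
  have dy: "(y has_field_derivative - 5 * \<kappa> * (G5 (Q w) / L5 (Q w)) / P w) (at w)" if "w \<in> U" for w
  proof -
    have "has_euler_deriv L5 (L5 (Q w) * G5 (Q w)) (Q w)"
      using L5_euler[OF Q(2)[OF that]] unfolding wp_combinations[OF Q[OF that]] .
    from DERIV_cmult[OF chain[OF that this], of \<kappa>]
    have "(y has_field_derivative \<kappa> * (L5 (Q w) * G5 (Q w) / (5 * w * V5 (Q w)))) (at w)"
      by (rule has_field_derivative_transform_within_open[OF _ U that]) (simp add: y)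
    moreover have "\<kappa> * (L5 (Q w) * G5 (Q w) / (5 * w * V5 (Q w))) = - 5 * \<kappa> * (G5 (Q w) / L5 (Q w)) / P w"
    proof -
      have e: "5 * w * V5 (Q w) = - (P w * L5 (Q w) ^ 2) / 5" unfolding PL[OF that] by simp
      show ?thesis unfolding e using nz[OF that] Pnz[OF that] by (simp add: field_simps power2_eq_square)
    qed
    ultimately show ?thesis by simp
  qed
  have dy': "deriv y w = - 5 * \<kappa> * (G5 (Q w) / L5 (Q w)) / P w" if "w \<in> U" for w
    using dy[OF that] by (rule DERIV_imp_deriv)
  have dGL: "((\<lambda>w. G5 (Q w) / L5 (Q w)) has_field_derivative 2 * A2 (Q w)) (at w)" if "w \<in> U" for w
  proof -
    have "has_euler_deriv (\<lambda>q. G5 q / L5 q)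
       (((G5 (Q w) ^ 2 + 10 * A2 (Q w) * M5 (Q w) * V5 (Q w)) * L5 (Q w)
          - G5 (Q w) * (L5 (Q w) * G5 (Q w))) / (L5 (Q w) * L5 (Q w))) (Q w)"
      using L5_euler[OF Q(2)[OF that]] unfolding wp_combinations[OF Q[OF that]]
      by (intro euler_deriv_divide G5_euler Q[OF that] nz[OF that])
    note chain[OF that this]
    moreover have "((G5 (Q w) ^ 2 + 10 * A2 (Q w) * M5 (Q w) * V5 (Q w)) * L5 (Q w)
          - G5 (Q w) * (L5 (Q w) * G5 (Q w))) / (L5 (Q w) * L5 (Q w)) / (5 * w * V5 (Q w)) = 2 * A2 (Q w)"
    proof -
      have "(G5 (Q w) ^ 2 + 10 * A2 (Q w) * M5 (Q w) * V5 (Q w)) * L5 (Q w) - G5 (Q w) * (L5 (Q w) * G5 (Q w))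
         = (2 * A2 (Q w)) * ((5 * w * V5 (Q w)) * (L5 (Q w) * L5 (Q w)))"
        unfolding M[OF that] by algebra
      then show ?thesis using nz[OF that] w0[OF that] by simp
    qed
    ultimately show ?thesis by simp
  qed
  define P' where "P' = (\<lambda>w. (w - fsing_plus) * (w - fsing_minus) + w * (w - fsing_minus) + w * (w - fsing_plus))"
  have dP: "(P has_field_derivative P' w) (at w)" for w
    unfolding P_def P'_def by (auto intro!: derivative_eq_intros simp: algebra_simps)
  show "(\<lambda>w. S_mod (g w)) holomorphic_on U"
    using dy unfolding y_def[symmetric] holomorphic_on_open[OF U] by blast
  fix w assume w: "w \<in> U"
  have ddy: "deriv (deriv y) w = (- 10 * \<kappa> * A2 (Q w) - deriv y w * P' w) / P w"
  proof -
    have "((\<lambda>w. - 5 * \<kappa> * (G5 (Q w) / L5 (Q w)) / P w) has_field_derivative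
       (- 5 * \<kappa> * (2 * A2 (Q w)) * P w - - 5 * \<kappa> * (G5 (Q w) / L5 (Q w)) * P' w) / (P w * P w)) (at w)"
      by (rule DERIV_divide[OF DERIV_cmult[OF dGL[OF w]] dP Pnz[OF w]])
    then have "(deriv y has_field_derivative
       (- 5 * \<kappa> * (2 * A2 (Q w)) * P w - - 5 * \<kappa> * (G5 (Q w) / L5 (Q w)) * P' w) / (P w * P w)) (at w)"
      by (rule has_field_derivative_transform_within_open[OF _ U w]) (simp add: dy')
    then have "deriv (deriv y) w = (- 5 * \<kappa> * (2 * A2 (Q w)) * P w - - 5 * \<kappa> * (G5 (Q w) / L5 (Q w)) * P' w) / (P w * P w)"
      by (rule DERIV_imp_deriv)
    also have "\<dots> = (- 10 * \<kappa> * A2 (Q w) - deriv y w * P' w) / P w"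
      unfolding dy'[OF w] using Pnz[OF w] by (simp add: diff_divide_distrib mult.assoc)
    finally show ?thesis .
  qed
  have ne: "w \<noteq> 0" "w - fsing_plus \<noteq> 0" "w - fsing_minus \<noteq> 0" using Pnz[OF w] by (auto simp: P_def)
  have log: "1 / w + 1 / (w - fsing_plus) + 1 / (w - fsing_minus) = P' w / P w"
    using ne by (simp add: P'_def P_def add_divide_distrib)
  have "(w - 3) * L5 (Q w) = 10 * A2 (Q w)"
    using M[OF w] unfolding M5_def L5_def by algebra
  then have wy: "(w - 3) * y w = 10 * \<kappa> * A2 (Q w)" unfolding y[OF w] by algebra
  have "(X - d * p) / r + p / r * d + c / r * v = (X + c * v) / r" for X d p r c v :: complex
    by (simp add: add_divide_distrib diff_divide_distrib mult.commute)
  then have "deriv (deriv y) w + P' w / P w * deriv y w + (w - 3) / P w * y w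
      = (- 10 * \<kappa> * A2 (Q w) + (w - 3) * y w) / P w"
    unfolding ddy by blast
  also have "\<dots> = 0" unfolding wy by simp
  finally have "deriv (deriv y) w + (1 / w + 1 / (w - fsing_plus) + 1 / (w - fsing_minus)) * deriv y w
      + (w - 3) / (w * (w - fsing_plus) * (w - fsing_minus)) * y w = 0"
    unfolding log by (simp only: P_def)
  then show "w \<noteq> 0 \<and> w \<noteq> fsing_plus \<and> w \<noteq> fsing_minus \<and>
     deriv (deriv (\<lambda>w. S_mod (g w))) w
       + (1 / w + 1 / (w - fsing_plus) + 1 / (w - fsing_minus)) * deriv (\<lambda>w. S_mod (g w)) w
       + (w - 3) / (w * (w - fsing_plus) * (w - fsing_minus)) * S_mod (g w) = 0"
    using ne unfolding y_def by simp
qed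

theorem theorem6p2:
  shows "(\<forall>\<tau>\<in>upper_half_plane.
            \<exists>U g. local_inverse_branch U g \<and> f_mod \<tau> \<in> U \<and> g (f_mod \<tau>) = \<tau>) \<and>
         (\<forall>U g. local_inverse_branch U g \<longrightarrow>
            (\<lambda>w. S_mod (g w)) holomorphic_on U \<and>
            (\<forall>w\<in>U.
               w \<noteq> 0 \<and> w \<noteq> fsing_plus \<and> w \<noteq> fsing_minus \<and>
               deriv (deriv (\<lambda>w. S_mod (g w))) w
               + (1 / w + 1 / (w - fsing_plus) + 1 / (w - fsing_minus))
                 * deriv (\<lambda>w. S_mod (g w)) w
               + (w - 3) / (w * (w - fsing_plus) * (w - fsing_minus)) * S_mod (g w) = 0))"
  using local_inverse_exists branch_satisfies_ode by blast

end
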